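(* Let $T>0$. Weak entropy solutions of the periodic Fornberg–Whitham problem on $\mathbb{T}\times[0,T]$ (as defined in the context) are unique. More precisely, if $u$ and $v$ are weak entropy solutions on $\mathbb{T}\times[0,T]$ with initial values $u_0\in L^\infty(\mathbb{T})$ and $v_0\in L^\infty(\mathbb{T})$, respectively, then for every $t\in[0,T]$, $$\int_{\mathbb{T}}|u(x,t)-v(x,t)|\,dx\le e^{t\|K'\|_{L^\infty(\mathbb{T})}}\int_{\mathbb{T}}|u_0(x)-v_0(x)|\,dx .$$
   Context: $\mathbb{T}=\mathbb{R}/\mathbb{Z}$, functions on $\mathbb{T}$ identified with $1$-periodic functions on $\mathbb{R}$. The Fornberg–Whitham problem is $u_t+uu_x+(1-\partial_x^2)^{-1}u_x=0$ for $x\in\mathbb{T},t>0$, $u(x,0)=u_0(x)$. Let $K:\mathbb{T}\to\mathbb{R}$ be given on $[0,1]$ by $K(x)=\frac{\sqrt e}{e-1}\cosh(x-\tfrac12)$, extended periodically; then $(1-\partial_x^2)^{-1}w_x=K'\ast w$ (convolution in $x$ over $\mathbb{T}$), where $K'$ is bounded. Given $u_0\in L^\infty(\mathbb{T})$ and $T>0$, a function $u\in L^\infty(\mathbb{T}\times[0,T])$ is a weak entropy solution if for every $\lambda\in\mathbb{R}$ and every nonnegative $C^1$ function $\phi$ with compact support in $\mathbb{T}\times\mathbb{R}$, $$0\le\int_0^T\!\!\int_{\mathbb{T}}\Big(|u-\lambda|\,\partial_t\phi+\operatorname{sgn}(u-\lambda)\tfrac{u^2-\lambda^2}{2}\partial_x\phi-\operatorname{sgn}(u-\lambda)\,\big(K'\ast(u(\cdot,t)-\lambda)\big)(x)\,\phi\Big)dx\,dt+\int_{\mathbb{T}}|u_0(x)-\lambda|\phi(x,0)\,dx,$$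 where $u=u(x,t)$, $\phi=\phi(x,t)$. Such $u$ are taken (after modification on a null set) to be the representative for which $t\mapsto u(\cdot,t)$ is weak-$*$ continuous $[0,T]\to L^\infty(\mathbb{T})$. *)

theory Defs
  imports "HOL-Analysis.Analysis" "HOL-Probability.Essential_Supremum"
begin

text \<open>Functions on the torus R/Z are 1-periodic functions on R; integrals over the torus
  are integrals over [0,1] w.r.t. Lebesgue measure.\<close>

definition periodic1 :: "(real \<Rightarrow> 'a) \<Rightarrow> bool" where
  "periodic1 f \<longleftrightarrow> (\<forall>x. f (x + 1) = f x)"

definition FW_K :: "real \<Rightarrow> real" where
  "FW_K x = sqrt (exp 1) / (exp 1 - 1) * cosh (frac x - 1/2)"

text \<open>Its (a.e.) derivative K', bounded, with jumps at the integers
  (the values at the integers are irrelevant: K' is only used inside integrals).\<close>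
definition FW_Kd :: "real \<Rightarrow> real" where
  "FW_Kd x = sqrt (exp 1) / (exp 1 - 1) * sinh (frac x - 1/2)"

definition FW_Kd_norm :: real where
  "FW_Kd_norm = real_of_ereal (esssup (lebesgue_on {0..1}) (\<lambda>x. ereal \<bar>FW_Kd x\<bar>))"

definition FW_conv :: "(real \<Rightarrow> real) \<Rightarrow> (real \<Rightarrow> real) \<Rightarrow> real \<Rightarrow> real" where
  "FW_conv k w x = (LINT y:{0..1}|lebesgue. k (x - y) * w y)"

definition Linf_T :: "(real \<Rightarrow> real) \<Rightarrow> bool" where
  "Linf_T f \<longleftrightarrow> periodic1 f \<and> f \<in> borel_measurable lebesgue \<and>
     (\<exists>M. AE x in lebesgue_on {0..1}. \<bar>f x\<bar> \<le> M)"

definition FW_test :: "(real \<Rightarrow> real \<Rightarrow> real) \<Rightarrow> (real \<Rightarrow> real \<Rightarrow> real) \<Rightarrow>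
    (real \<Rightarrow> real \<Rightarrow> real) \<Rightarrow> bool" where
  "FW_test ph phx pht \<longleftrightarrow>
     (\<forall>x t. 0 \<le> ph x t) \<and>
     (\<forall>x t. ph (x + 1) t = ph x t) \<and>
     (\<forall>x t. ((\<lambda>s. ph s t) has_real_derivative phx x t) (at x)) \<and>
     (\<forall>x t. ((\<lambda>s. ph x s) has_real_derivative pht x t) (at t)) \<and>
     continuous_on UNIV (\<lambda>p. ph (fst p) (snd p)) \<and>
     continuous_on UNIV (\<lambda>p. phx (fst p) (snd p)) \<and>
     continuous_on UNIV (\<lambda>p. pht (fst p) (snd p)) \<and>
     (\<exists>R. \<forall>x t. R < \<bar>t\<bar> \<longrightarrow> ph x t = 0)"

text \<open>Weak entropy solution u (u x t = u(x,t)) on T x [0,T] with initial value u0, taken as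
  the representative for which t -> u(.,t) is weak-* continuous [0,T] -> L-infinity(T).\<close>
definition FW_entropy_solution :: "real \<Rightarrow> (real \<Rightarrow> real) \<Rightarrow> (real \<Rightarrow> real \<Rightarrow> real) \<Rightarrow> bool" where
  "FW_entropy_solution T u0 u \<longleftrightarrow>
     Linf_T u0 \<and>
     \<comment> \<open>u in L-infinity(T x [0,T])\<close>
     (\<forall>x t. u (x + 1) t = u x t) \<and>
     (\<lambda>p. u (fst p) (snd p)) \<in> borel_measurable lebesgue \<and>
     (\<exists>M. AE p in lebesgue_on ({0..1} \<times> {0..T}). \<bar>u (fst p) (snd p)\<bar> \<le> M) \<and>
     \<comment> \<open>weak-* continuous representative\<close>
     (\<forall>t\<in>{0..T}. Linf_T (\<lambda>x. u x t)) \<and>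
     (\<forall>g. set_integrable lebesgue {0..1} g \<longrightarrow>
        continuous_on {0..T} (\<lambda>t. LINT x:{0..1}|lebesgue. u x t * g x)) \<and>
     \<comment> \<open>entropy inequalities\<close>
     (\<forall>lam::real. \<forall>ph phx pht. FW_test ph phx pht \<longrightarrow>
        0 \<le> (LINT t:{0..T}|lebesgue. LINT x:{0..1}|lebesgue.
                 \<bar>u x t - lam\<bar> * pht x t
               + sgn (u x t - lam) * ((u x t)\<^sup>2 - lam\<^sup>2) / 2 * phx x t
               - sgn (u x t - lam) * FW_conv FW_Kd (\<lambda>y. u y t - lam) x * ph x t)
           + (LINT x:{0..1}|lebesgue. \<bar>u0 x - lam\<bar> * ph x 0))"

end

theory Submission
  imports Defs
begin

text \<open>Kruzkov's doubling of variables. The entropy inequality for \<open>u\<close> with constant \<open>v (y, s)\<close> and the one for \<open>v\<close>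
  with constant \<open>u (x, t)\<close> are tested with \<open>\<eta> t * \<theta> (s - t) * \<omega> (x - y)\<close> and added. The fluxes cancel, and since
  \<open>K'\<close> has mean zero the constants drop out of the nonlocal terms, which combine to at most
  \<open>\<bar>K' * u (\<cdot>, t) (x) - K' * v (\<cdot>, s) (y)\<bar>\<close>. Concentrating \<open>\<theta>\<close> and then \<open>\<omega>\<close> at zero gives
  \<open>0 \<le> \<integral> D (\<eta>' + L \<eta>) + \<eta> 0 * D0\<close> for the \<open>L\<^sup>1\<close> distance \<open>D\<close> and \<open>L = \<parallel>K'\<parallel>\<close>; here \<open>\<theta>\<close> has to be
  concentrated much faster than \<open>\<omega>\<close> because of the initial data. Choosing \<open>\<eta>\<close> as \<open>exp (- L t)\<close> times a
  decreasing cutoff yields the bound for averages of \<open>D\<close> over short time intervals, and weak-* continuity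
  transfers it to every single time.\<close>

text \<open>Information about the initial data enters through the entropy inequalities alone; no
  solution is assumed to attain its data in L^1. This is why \<theta> is one-sided and why the
  remaining initial term has to be compared with the data of v by a further use of the inequality
  for v. The price of that comparison is a bound on \<omega>' times the time width, and the bound on
  \<omega>' grows as \<omega> concentrates: hence the order of the two limits. The doubling is done
  for arbitrary bounded sources \<open>A\<close> and \<open>B\<close>. The nonlocal term is such a
  source because the zero mean of K' makes it independent of the Kruzkov constant. The two sources
  differ at time t by at most L times D (t), uniformly in x, and the torus has length one, so the
  rate is L with no further constant. A Borel representative on space-time determines almost every
  time slice but no prescribed one, and weak-* continuity does not make D continuous. The last step
  therefore uses only lower semicontinuity of the L^1 norm.\<close>

subsection \<open>Bounded measurable functions on finite measure spaces\<close>

text \<open>The bound holds at every point of the space, not just almost everywhere, so the class is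
  stable under sections and compositions and yields integrability on any finite measure space at
  once.\<close>

definition bdd_meas :: "'a measure \<Rightarrow> ('a \<Rightarrow> real) \<Rightarrow> bool" where
  "bdd_meas M f \<longleftrightarrow> f \<in> borel_measurable M \<and> (\<exists>B. \<forall>x\<in>space M. \<bar>f x\<bar> \<le> B)"

lemma bdd_measD [dest]: "bdd_meas M f \<Longrightarrow> f \<in> borel_measurable M"
  by (simp add: bdd_meas_def)

lemma bdd_measE:
  assumes "bdd_meas M f"
  obtains B where "f \<in> borel_measurable M" "0 \<le> B" "\<And>x. x \<in> space M \<Longrightarrow> \<bar>f x\<bar> \<le> B"
proof -
  obtain B where B: "\<forall>x\<in>space M. \<bar>f x\<bar> \<le> B" using assms by (auto simp: bdd_meas_def)
  show ?thesis by (rule that[of "max 0 B"]) (use assms B in \<open>fastforce simp: bdd_meas_def\<close>)+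
qed

lemma bdd_measI: "f \<in> borel_measurable M \<Longrightarrow> (\<And>x. x \<in> space M \<Longrightarrow> \<bar>f x\<bar> \<le> B) \<Longrightarrow> bdd_meas M f"
  by (auto simp: bdd_meas_def)

lemma bdd_meas_const [intro]: "bdd_meas M (\<lambda>_. c)"
  by (rule bdd_measI[of _ _ "\<bar>c\<bar>"]) auto

lemma bdd_meas_add [intro]: "bdd_meas M f \<Longrightarrow> bdd_meas M g \<Longrightarrow> bdd_meas M (\<lambda>x. f x + g x)"
  by (elim bdd_measE, rule bdd_measI[of _ _ "_ + _"])
     (auto intro!: abs_triangle_ineq[THEN order_trans] add_mono)

lemma bdd_meas_uminus [intro]: "bdd_meas M f \<Longrightarrow> bdd_meas M (\<lambda>x. - f x)"
  by (auto simp: bdd_meas_def)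

lemma bdd_meas_diff [intro]: "bdd_meas M f \<Longrightarrow> bdd_meas M g \<Longrightarrow> bdd_meas M (\<lambda>x. f x - g x)"
  using bdd_meas_add[OF _ bdd_meas_uminus, of M f g] by simp

lemma bdd_meas_mult [intro]: "bdd_meas M f \<Longrightarrow> bdd_meas M g \<Longrightarrow> bdd_meas M (\<lambda>x. f x * g x)"
  by (elim bdd_measE, rule bdd_measI[of _ _ "_ * _"])
     (auto intro!: mult_mono simp: abs_mult)

lemma bdd_meas_abs [intro]: "bdd_meas M f \<Longrightarrow> bdd_meas M (\<lambda>x. \<bar>f x\<bar>)"
  by (auto simp: bdd_meas_def)

lemma bdd_meas_sgn [intro]: "bdd_meas M f \<Longrightarrow> bdd_meas M (\<lambda>x. sgn (f x))"
  by (rule bdd_measI[of _ _ 1]) (auto simp: sgn_if)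

lemma bdd_meas_divide [intro]: "bdd_meas M f \<Longrightarrow> bdd_meas M (\<lambda>x. f x / c)"
  using bdd_meas_mult[OF _ bdd_meas_const, of M f "1 / c"] by simp

lemma bdd_meas_comp: "bdd_meas N f \<Longrightarrow> g \<in> measurable M N \<Longrightarrow> bdd_meas M (\<lambda>x. f (g x))"
  by (auto simp: bdd_meas_def dest: measurable_space)

lemma bdd_meas_cong_sets: "sets M = sets N \<Longrightarrow> bdd_meas M f \<longleftrightarrow> bdd_meas N f"
  by (metis bdd_meas_def measurable_cong_sets sets_eq_imp_space_eq)

lemma bdd_meas_section: "bdd_meas (M \<Otimes>\<^sub>M N) f \<Longrightarrow> x \<in> space M \<Longrightarrow> bdd_meas N (\<lambda>y. f (x, y))"
  by (erule bdd_meas_comp) auto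

lemma (in finite_measure) bdd_meas_integrable: "bdd_meas M f \<Longrightarrow> integrable M f"
  by (elim bdd_measE, rule integrable_const_bound) (auto simp: bdd_meas_def)

lemma (in finite_measure) bdd_meas_integral [intro]:
  assumes "bdd_meas (N \<Otimes>\<^sub>M M) f"
  shows "bdd_meas N (\<lambda>x. \<integral>y. f (x, y) \<partial>M)"
proof -
  obtain B where B: "0 \<le> B" "\<And>x. x \<in> space (N \<Otimes>\<^sub>M M) \<Longrightarrow> \<bar>f x\<bar> \<le> B"
    using assms by (elim bdd_measE) blast
  have [measurable]: "f \<in> borel_measurable (N \<Otimes>\<^sub>M M)" using assms by auto
  show ?thesis
  proof (rule bdd_measI[where B = "measure M (space M) * B"])
    fix x assume x: "x \<in> space N"
    have "\<bar>\<integral>y. f (x, y) \<partial>M\<bar> \<le> (\<integral>y. \<bar>f (x, y)\<bar> \<partial>M)"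
      by (rule integral_abs_bound)
    also have "\<dots> \<le> (\<integral>y. B \<partial>M)"
      by (intro integral_mono bdd_meas_integrable bdd_meas_abs bdd_meas_section[OF assms] x bdd_meas_const B)
         (use x in \<open>auto simp: space_pair_measure\<close>)
    finally show "\<bar>\<integral>y. f (x, y) \<partial>M\<bar> \<le> measure M (space M) * B" by simp
  qed measurable
qed

lemma
  fixes f :: "'a \<times> 'b \<Rightarrow> real"
  assumes "finite_measure M" "finite_measure N" "bdd_meas (M \<Otimes>\<^sub>M N) f"
  shows integral_pair_fst: "(\<integral>x. \<integral>y. f (x, y) \<partial>N \<partial>M) = (\<integral>z. f z \<partial>(M \<Otimes>\<^sub>M N))"
    and integral_pair_snd: "(\<integral>y. \<integral>x. f (x, y) \<partial>M \<partial>N) = (\<integral>z. f z \<partial>(M \<Otimes>\<^sub>M N))"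
proof -
  interpret M: finite_measure M by fact
  interpret N: finite_measure N by fact
  interpret pair_sigma_finite M N ..
  interpret P: finite_measure "M \<Otimes>\<^sub>M N"
    by (rule finite_measure_pair_measure) fact+
  have "integrable (M \<Otimes>\<^sub>M N) (\<lambda>(x, y). f (x, y))"
    using P.bdd_meas_integrable[OF assms(3)] by simp
  from integral_fst[OF this] integral_snd[OF this]
  show "(\<integral>x. \<integral>y. f (x, y) \<partial>N \<partial>M) = (\<integral>z. f z \<partial>(M \<Otimes>\<^sub>M N))"
    "(\<integral>y. \<integral>x. f (x, y) \<partial>M \<partial>N) = (\<integral>z. f z \<partial>(M \<Otimes>\<^sub>M N))"
    by simp_all
qed

subsection \<open>Lebesgue measure on intervals and space-time slabs\<close>

text \<open>A density instead of a restriction, so that the measurable sets are all Borel sets of the line.\<close>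

definition iv :: "real \<Rightarrow> real measure" where
  "iv T = density lborel (indicator {0..T})"

abbreviation slab :: "real \<Rightarrow> (real \<times> real) measure" where
  "slab T \<equiv> iv 1 \<Otimes>\<^sub>M iv T"

lemma sets_iv [simp, measurable_cong]: "sets (iv T) = sets borel"
  by (simp add: iv_def)

lemma space_iv [simp]: "space (iv T) = UNIV"
  by (simp add: iv_def)

lemma finite_measure_iv [intro, simp]: "finite_measure (iv T)"
  by (rule finite_measureI) (simp add: iv_def emeasure_density emeasure_lborel_Icc_eq)

lemma finite_measure_slab [intro, simp]: "finite_measure (slab T)"
  by (intro finite_measure_pair_measure finite_measure_iv)

lemma sets_slab: "sets (slab T) = sets (borel :: (real \<times> real) measure)"
  unfolding borel_prod[symmetric] by (intro sets_pair_measure_cong) simp_all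

lemma integral_iv:
  fixes f :: "real \<Rightarrow> real"
  shows "f \<in> borel_measurable borel \<Longrightarrow> (\<integral>x. f x \<partial>iv T) = (LINT x:{0..T}|lborel. f x)"
proof -
  assume [measurable]: "f \<in> borel_measurable borel"
  have *: "density lborel (indicator {0..T}) = density lborel (\<lambda>x. ennreal (indicator {0..T} x))"
    by (intro density_cong) (auto split: split_indicator)
  show ?thesis
    unfolding iv_def * set_lebesgue_integral_def by (subst integral_density) auto
qed

lemma AE_iv_iff: "(AE x in iv T. P x) \<longleftrightarrow> (AE x in lborel. x \<in> {0..T} \<longrightarrow> P x)"
  unfolding iv_def by (subst AE_density) (auto simp: indicator_def)

lemma AE_iv: "AE x in iv T. x \<in> {0..T}"
  by (simp add: AE_iv_iff)

lemma measure_iv [simp]: "0 \<le> T \<Longrightarrow> measure (iv T) UNIV = T"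
  by (simp add: iv_def measure_def emeasure_density)

lemma AE_slab: "AE p in slab T. fst p \<in> {0..1} \<and> snd p \<in> {0..T}"
proof -
  interpret finite_measure "iv 1" by simp
  interpret N: finite_measure "iv T" by simp
  interpret pair_sigma_finite "iv 1" "iv T" ..
  have "AE x in iv 1. AE y in iv T. (\<lambda>p. fst p \<in> {0..1} \<and> snd p \<in> {0..T}) (x, y)"
    using AE_iv[of 1] by eventually_elim (use AE_iv[of T] in eventually_elim, simp)
  then show ?thesis
    by (rule AE_pair_measure[rotated]) measurable
qed

text \<open>A product of two densities is a density of the planar Lebesgue measure, so planar null
  sets remain null on the slab.\<close>

lemma AE_slabI:
  assumes "AE z in lborel. z \<in> {0..1} \<times> {0..T} \<longrightarrow> P z"
  shows "AE z in slab T. P z"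
proof -
  interpret N: finite_measure "density lborel (indicator {0..T} :: real \<Rightarrow> ennreal)"
    using finite_measure_iv[of T] by (simp add: iv_def)
  have eq: "slab T = density (lborel \<Otimes>\<^sub>M lborel) (\<lambda>(x, y). indicator {0..1} x * indicator {0..T} y)"
    unfolding iv_def by (rule pair_measure_density) (auto intro!: lborel.sigma_finite_measure_axioms N.sigma_finite_measure_axioms)
  have meas: "(\<lambda>(x, y). indicator {0..1} x * indicator {0..T} y :: ennreal)
      \<in> borel_measurable ((lborel :: real measure) \<Otimes>\<^sub>M (lborel :: real measure))"
    by measurable
  show ?thesis
    unfolding eq AE_density[OF meas] unfolding lborel_prod
    by (rule eventually_mono[OF assms]) (auto split: split_indicator_asm)
qed

lemma integral_iv_FTC:
  assumes "0 \<le> T" "\<And>x. (F has_real_derivative f x) (at x)" "continuous_on UNIV f"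
  shows "(\<integral>x. f x \<partial>iv T) = F T - F 0"
proof -
  have "f \<in> borel_measurable borel" using assms(3) by (rule borel_measurable_continuous_onI)
  then have "(\<integral>x. f x \<partial>iv T) = (LINT x:{0..T}|lborel. f x)" by (rule integral_iv)
  also have "\<dots> = F T - F 0"
    unfolding set_lebesgue_integral_def
    using integral_FTC_Icc_real[of 0 T F f] assms
    by (auto simp: mult.commute continuous_on_eq_continuous_at)
  finally show ?thesis .
qed

subsection \<open>Mollifiers\<close>

lemma ex_antiderivative:
  fixes f :: "real \<Rightarrow> real"
  assumes "continuous_on UNIV f"
  obtains F where "\<And>x. (F has_real_derivative f x) (at x)"
proof
  fix x :: real
  \<comment> \<open>The interval contains the base point 0 and has x in its interior, so the
    derivative within it is the full derivative at x.\<close>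
  let ?a = "- \<bar>x\<bar> - 1" and ?b = "\<bar>x\<bar> + 1"
  have "((\<lambda>u. LBINT y=(0::real)..u. f y) has_vector_derivative f x) (at x within {?a..?b})"
    by (rule interval_integral_FTC2) (use assms in \<open>auto intro: continuous_on_subset\<close>)
  moreover have "at x within {?a..?b} = at x"
    by (rule at_within_interior) (simp, arith)
  ultimately show "((\<lambda>u. LBINT y=(0::real)..u. f y) has_real_derivative f x) (at x)"
    by (simp add: has_real_derivative_iff_has_vector_derivative)
qed

text \<open>Squaring the positive part of a polynomial or of a shifted cosine gives a bump that is
  C^1, which is the regularity \<open>FW_test\<close> demands.\<close>

lemma DERIV_max0_square:
  fixes x :: real
  shows "((\<lambda>x. (max 0 x)\<^sup>2) has_real_derivative 2 * max 0 x) (at x)"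
proof -
  consider "x < 0" | "x = 0" | "x > 0" by linarith
  then show ?thesis
  proof cases
    case 1
    show ?thesis
      by (rule has_field_derivative_transform_within_open[where f = "\<lambda>_. 0" and S = "{..<0}"])
         (use 1 in auto)
  next
    case 2
    have "(\<lambda>h::real. (max 0 h)\<^sup>2 / h) \<midarrow>0\<rightarrow> 0"
    proof (rule Lim_null_comparison[where g = "\<lambda>h. \<bar>h\<bar>"])
      show "\<forall>\<^sub>F h::real in at 0. norm ((max 0 h)\<^sup>2 / h) \<le> \<bar>h\<bar>"
        by (rule always_eventually) (auto simp: max_def power2_eq_square)
    qed (auto intro!: tendsto_eq_intros)
    then show ?thesis unfolding 2 DERIV_def by simp
  next
    case 3
    show ?thesis
      by (rule has_field_derivative_transform_within_open[where f = "\<lambda>x. x\<^sup>2" and S = "{0<..}"])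
         (use 3 in \<open>auto intro!: derivative_eq_intros\<close>)
  qed
qed

lemma mono_if_deriv_nonneg:
  fixes F :: "real \<Rightarrow> real"
  assumes "\<And>x. (F has_real_derivative f x) (at x)" "\<And>x. 0 \<le> f x" "x \<le> y"
  shows "F x \<le> F y"
  using DERIV_nonneg_imp_nondecreasing[OF assms(3), of F] assms(1,2) by blast

lemma DERIV_shift_left:
  assumes "\<And>x. (F has_real_derivative f x) (at x)"
  shows "((\<lambda>x. F (x - y)) has_real_derivative f (x - y)) (at x)"
  using DERIV_chain2[OF assms, of "\<lambda>x. x - y" 1 x UNIV]
  by (simp add: DERIV_diff[OF DERIV_ident DERIV_const, simplified])

lemma DERIV_shift_right:
  assumes "\<And>x. (F has_real_derivative f x) (at x)"
  shows "((\<lambda>y. F (x - y)) has_real_derivative - f (x - y)) (at y)"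
  using DERIV_chain2[OF assms, of "\<lambda>y. x - y" "-1" y UNIV]
  by (simp add: DERIV_diff[OF DERIV_const DERIV_ident, simplified])

lemma bdd_meas_compact_support:
  fixes f :: "real \<Rightarrow> real"
  assumes "continuous_on UNIV f" "\<And>x. x \<notin> {a..b} \<Longrightarrow> f x = 0"
  shows "bdd_meas borel f"
proof -
  have "compact (f ` {a..b})"
    by (intro compact_continuous_image continuous_on_subset[OF assms(1)]) auto
  then obtain B where B: "\<forall>y\<in>f ` {a..b}. \<bar>y\<bar> \<le> B"
    using compact_imp_bounded bounded_real by blast
  have "\<bar>f x\<bar> \<le> max 0 B" for x
    using B assms(2)[of x] by (cases "x \<in> {a..b}") (auto simp: le_max_iff_disj)
  then show ?thesis
    by (intro bdd_measI borel_measurable_continuous_onI assms(1))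
qed

lemma periodic_add_int:
  fixes f :: "real \<Rightarrow> 'a"
  assumes "\<And>x. f (x + 1) = f x"
  shows "f (x + of_int k) = f x"
proof (induction k rule: int_induct[of _ 0])
  case (step1 i)
  then show ?case using assms[of "x + of_int i"] by (simp add: add.assoc)
next
  case (step2 i)
  then show ?case using assms[of "x + of_int (i - 1)"] by (simp add: add.assoc)
qed simp

lemma bdd_meas_periodic:
  fixes f :: "real \<Rightarrow> real"
  assumes "continuous_on UNIV f" "\<And>x. f (x + 1) = f x"
  shows "bdd_meas borel f"
proof -
  have "compact (f ` {0..1})"
    by (intro compact_continuous_image continuous_on_subset[OF assms(1)]) auto
  then obtain B where B: "\<forall>y\<in>f ` {0..1}. \<bar>y\<bar> \<le> B"
    using compact_imp_bounded bounded_real by blast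
  have "\<bar>f x\<bar> \<le> B" for x
  proof -
    have "f x = f (frac x)"
      using periodic_add_int[of f "frac x" "\<lfloor>x\<rfloor>", OF assms(2)] by (simp add: frac_def)
    then show ?thesis using B by (simp add: frac_lt_1 less_imp_le)
  qed
  then show ?thesis
    by (intro bdd_measI borel_measurable_continuous_onI assms(1))
qed

text \<open>The kernels carry an antiderivative, which turns all their marginals into differences of its values.\<close>

definition time_kernel :: "real \<Rightarrow> (real \<Rightarrow> real) \<Rightarrow> (real \<Rightarrow> real) \<Rightarrow> (real \<Rightarrow> real) \<Rightarrow> bool" where
  "time_kernel e X \<theta> \<theta>' \<longleftrightarrow>
     (\<forall>s. (X has_real_derivative - \<theta> s) (at s)) \<and> (\<forall>s. (\<theta> has_real_derivative \<theta>' s) (at s)) \<and>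
     continuous_on UNIV \<theta>' \<and> (\<forall>s. 0 \<le> \<theta> s) \<and>
     (\<forall>s. s \<le> 0 \<or> e \<le> s \<longrightarrow> \<theta> s = 0 \<and> \<theta>' s = 0) \<and>
     (\<forall>s\<le>0. X s = 1) \<and> (\<forall>s\<ge>e. X s = 0)"

text \<open>\<open>W (x + 1) = W x + 1\<close> encodes unit mass over each period; the support
  condition is distance less than d on the circle, i.e. to some integer.\<close>

definition space_kernel :: "real \<Rightarrow> (real \<Rightarrow> real) \<Rightarrow> (real \<Rightarrow> real) \<Rightarrow> (real \<Rightarrow> real) \<Rightarrow> bool" where
  "space_kernel d W \<omega> \<omega>' \<longleftrightarrow>
     (\<forall>x. (W has_real_derivative \<omega> x) (at x)) \<and> (\<forall>x. (\<omega> has_real_derivative \<omega>' x) (at x)) \<and>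
     continuous_on UNIV \<omega>' \<and> (\<forall>x. 0 \<le> \<omega> x) \<and>
     (\<forall>x. \<omega> (x + 1) = \<omega> x \<and> \<omega>' (x + 1) = \<omega>' x \<and> W (x + 1) = W x + 1) \<and>
     (\<forall>x. \<omega> x \<noteq> 0 \<longrightarrow> (\<exists>k::int. \<bar>x - k\<bar> < d))"

section \<open>Construction of the kernels\<close>

lemma has_real_derivative_imp_continuous_on:
  "(\<And>x. (f has_real_derivative f' x) (at x)) \<Longrightarrow> continuous_on UNIV f"
  by (meson DERIV_isCont continuous_at_imp_continuous_on)

lemma ex_time_kernel:
  assumes "0 < e"
  obtains X \<theta> \<theta>' where "time_kernel e X \<theta> \<theta>'"
proof -
  define p p' :: "real \<Rightarrow> real" where "p s = (max 0 (s * (e - s)))\<^sup>2"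
    and "p' s = 2 * max 0 (s * (e - s)) * (e - 2 * s)" for s
  have p: "(p has_real_derivative p' s) (at s)" for s
    unfolding p_def p'_def
    by (rule DERIV_chain2[OF DERIV_max0_square]) (auto intro!: derivative_eq_intros)
  have cont: "continuous_on UNIV p" "continuous_on UNIV p'"
    unfolding p_def p'_def by (intro continuous_intros)+
  have p0: "p s = 0" "p' s = 0" if "s \<le> 0 \<or> e \<le> s" for s
  proof -
    have "s * (e - s) \<le> 0" using that assms by (auto simp: mult_le_0_iff)
    then show "p s = 0" "p' s = 0" by (auto simp: p_def p'_def)
  qed
  obtain F where F: "(F has_real_derivative p s) (at s)" for s
    using ex_antiderivative[OF cont(1)] by blast
  have F_eq: "F b = F a" if "a \<le> b" "b \<le> 0 \<or> e \<le> a" for a b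
  proof (cases "a = b")
    case False
    then have "a < b" using that by simp
    then obtain z where "a < z" "z < b" "F b - F a = (b - a) * p z"
      using MVT2[of a b F p] F by blast
    then show ?thesis using that p0[of z] by auto
  qed auto
  \<comment> \<open>The mean value theorem shows that the total mass is positive: it is e times the
    value of p at an interior point.\<close>
  obtain z where z: "0 < z" "z < e" "F e - F 0 = (e - 0) * p z"
    using MVT2[of 0 e F p] F assms by blast
  then have "0 < p z" by (auto simp: p_def)
  define I where "I = F e - F 0"
  have I: "0 < I" using z \<open>0 < p z\<close> assms by (simp add: I_def)
  show ?thesis
  \<comment> \<open>The antiderivative is normalised as the fraction of the mass to the right of s,
    hence 1 before the support and 0 behind it.\<close>
  proof (rule that[of "\<lambda>s. (F e - F s) / I" "\<lambda>s. p s / I" "\<lambda>s. p' s / I"], unfold time_kernel_def, safe)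
    fix s
    show "((\<lambda>s. (F e - F s) / I) has_real_derivative - (p s / I)) (at s)"
      using F I by (auto intro!: derivative_eq_intros)
    show "((\<lambda>s. p s / I) has_real_derivative p' s / I) (at s)"
      using p I by (auto intro!: derivative_eq_intros)
    show "continuous_on UNIV (\<lambda>s. p' s / I)"
      using I cont by (auto intro!: continuous_intros)
    show "0 \<le> p s / I" using I by (simp add: p_def)
    show "(F e - F s) / I = 1" if "s \<le> 0" using F_eq[of s 0] that I by (simp add: I_def)
    show "(F e - F s) / I = 0" if "e \<le> s" using F_eq[of e s] that I by simp
  qed (use p0 in auto)
qed

text \<open>The cosine makes the bump periodic without summing translates: for d < 1/2, cos (2 pi x)
  exceeds cos (2 pi d) exactly when x is closer than d to an integer.\<close>

lemma ex_space_kernel: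
  assumes "0 < d" "d < 1/2"
  obtains W \<omega> \<omega>' where "space_kernel d W \<omega> \<omega>'"
proof -
  define c c' :: "real \<Rightarrow> real" where "c x = (max 0 (cos (2 * pi * x) - cos (2 * pi * d)))\<^sup>2"
    and "c' x = 2 * max 0 (cos (2 * pi * x) - cos (2 * pi * d)) * (- sin (2 * pi * x) * (2 * pi))" for x
  have c: "(c has_real_derivative c' x) (at x)" for x
    unfolding c_def c'_def
    by (rule DERIV_chain2[OF DERIV_max0_square]) (auto intro!: derivative_eq_intros)
  have cont: "continuous_on UNIV c" "continuous_on UNIV c'"
    unfolding c_def c'_def by (intro continuous_intros)+
  have per: "c (x + 1) = c x" "c' (x + 1) = c' x" for x
    by (simp_all add: c_def c'_def distrib_left)
  obtain F where F: "(F has_real_derivative c x) (at x)" for x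
    using ex_antiderivative[OF cont(1)] by blast
  obtain z where z: "0 < z" "z < d" "F d - F 0 = (d - 0) * c z"
    using MVT2[of 0 d F c] F assms by blast
  have "2 * pi * z < 2 * pi * d" using z by simp
  moreover have "2 * pi * d \<le> pi" using assms by simp
  ultimately have "cos (2 * pi * d) < cos (2 * pi * z)"
    using z by (intro cos_monotone_0_pi) auto
  then have "0 < c z" by (simp add: c_def)
  define I where "I = F 1 - F 0"
  have "F d \<le> F 1"
    by (rule mono_if_deriv_nonneg[OF F]) (use assms in \<open>auto simp: c_def\<close>)
  then have I: "0 < I"
    using z mult_pos_pos[OF assms(1) \<open>0 < c z\<close>] by (simp add: I_def)
  have F_per: "F (x + 1) - F x = I" for x
  proof -
    have "((\<lambda>x. F (x + 1) - F x) has_real_derivative c (x + 1) * 1 - c x) (at x)" for x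
      by (intro DERIV_diff DERIV_chain2[OF F] F) (auto intro!: derivative_eq_intros)
    then have "\<forall>x. ((\<lambda>x. F (x + 1) - F x) has_real_derivative 0) (at x)" by (simp add: per)
    from DERIV_isconst_all[OF this, of x 0] show ?thesis by (simp add: I_def)
  qed
  show ?thesis
  proof (rule that[of "\<lambda>x. F x / I" "\<lambda>x. c x / I" "\<lambda>x. c' x / I"], unfold space_kernel_def, safe)
    fix x
    show "((\<lambda>x. F x / I) has_real_derivative c x / I) (at x)"
      using F I by (auto intro!: derivative_eq_intros)
    show "((\<lambda>x. c x / I) has_real_derivative c' x / I) (at x)"
      using c I by (auto intro!: derivative_eq_intros)
    show "continuous_on UNIV (\<lambda>x. c' x / I)"
      using I cont by (auto intro!: continuous_intros)
    show "0 \<le> c x / I" using I by (simp add: c_def)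
    show "F (x + 1) / I = F x / I + 1" using F_per[of x] I by (simp add: field_simps)
    assume "c x / I \<noteq> 0"
    then have "cos (2 * pi * d) < cos (2 * pi * x)" by (auto simp: c_def)
    \<comment> \<open>Passing to the distance from the nearest integer, which is at most 1/2, brings
      the argument into the range from 0 to pi where the cosine decreases.\<close>
    also have "cos (2 * pi * x) = cos (2 * pi * (x - of_int (round x)))"
      using cos.plus_of_int[of "2 * pi * x" "- round x"] by (simp add: algebra_simps)
    also have "\<dots> = cos (2 * pi * \<bar>x - of_int (round x)\<bar>)"
      by (simp add: abs_if algebra_simps) (metis cos_minus minus_diff_eq)
    finally have lt: "cos (2 * pi * d) < cos (2 * pi * \<bar>x - of_int (round x)\<bar>)" .
    have half: "\<bar>x - of_int (round x)\<bar> \<le> 1/2"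
      using of_int_round_abs_le[of x] by (simp add: abs_minus_commute)
    have "\<bar>x - of_int (round x)\<bar> < d"
    proof (rule ccontr)
      assume "\<not> ?thesis"
      then have "cos (2 * pi * \<bar>x - of_int (round x)\<bar>) \<le> cos (2 * pi * d)"
        using half assms by (intro cos_monotone_0_pi_le) auto
      with lt show False by simp
    qed
    then show "\<exists>k::int. \<bar>x - of_int k\<bar> < d" by blast
  qed (use per in auto)
qed

section \<open>Support, size and mass of the kernels\<close>

context
  fixes e X \<theta> \<theta>'
  assumes tk: "time_kernel e X \<theta> \<theta>'"
begin

lemma time_kernel_DERIV:
  "(X has_real_derivative - \<theta> s) (at s)" "(\<theta> has_real_derivative \<theta>' s) (at s)"
  using tk by (simp_all add: time_kernel_def)

lemma time_kernel_pos: "0 \<le> \<theta> s"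
  using tk by (simp add: time_kernel_def)

lemma time_kernel_support:
  assumes "\<theta> s \<noteq> 0" shows "0 < s" "s < e"
  using assms tk unfolding time_kernel_def by (meson not_le)+

lemma time_kernel_bdd: "bdd_meas borel \<theta>" "bdd_meas borel \<theta>'"
proof -
  have "continuous_on UNIV \<theta>"
    using tk by (intro has_real_derivative_imp_continuous_on) (auto simp: time_kernel_def)
  then show "bdd_meas borel \<theta>"
    by (rule bdd_meas_compact_support[where a = 0 and b = e]) (use tk in \<open>auto simp: time_kernel_def\<close>)
  show "bdd_meas borel \<theta>'"
    by (rule bdd_meas_compact_support[where a = 0 and b = e]) (use tk in \<open>auto simp: time_kernel_def\<close>)
qed

lemma time_kernel_antimono: "s \<le> t \<Longrightarrow> X t \<le> X s"
  using mono_if_deriv_nonneg[of "\<lambda>s. - X s" \<theta> s t] DERIV_minus[OF time_kernel_DERIV(1)] tk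
  by (simp add: time_kernel_def)

lemma time_kernel_nonneg: "0 \<le> X s"
  using time_kernel_antimono[of s "max s e"] tk by (auto simp: time_kernel_def)

lemma time_kernel_le_1: "X s \<le> 1"
  using time_kernel_antimono[of "min s 0" s] tk by (auto simp: time_kernel_def)

lemma time_kernel_bdd_antideriv: "bdd_meas borel X"
proof (rule bdd_measI)
  have "continuous_on UNIV X"
    using tk by (intro has_real_derivative_imp_continuous_on) (auto simp: time_kernel_def)
  then show "X \<in> borel_measurable borel" by (rule borel_measurable_continuous_onI)
  show "\<bar>X x\<bar> \<le> 1" for x using time_kernel_nonneg[of x] time_kernel_le_1[of x] by simp
qed

lemma integral_time_kernel_fst:
  assumes "0 \<le> T"
  shows "(\<integral>s. \<theta> (s - t) \<partial>iv T) = X (- t) - X (T - t)"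
proof -
  have "(\<integral>s. \<theta> (s - t) \<partial>iv T) = - X (T - t) - (- X (0 - t))"
  proof (rule integral_iv_FTC[OF assms])
    show "((\<lambda>s. - X (s - t)) has_real_derivative \<theta> (x - t)) (at x)" for x
      using DERIV_minus[OF DERIV_shift_left[OF time_kernel_DERIV(1), of t x]] by simp
    show "continuous_on UNIV (\<lambda>s. \<theta> (s - t))"
      by (rule has_real_derivative_imp_continuous_on[OF DERIV_shift_left[OF time_kernel_DERIV(2)]])
  qed
  then show ?thesis by simp
qed

lemma integral_time_kernel_snd:
  assumes "0 \<le> T"
  shows "(\<integral>t. \<theta> (s - t) \<partial>iv T) = X (s - T) - X s"
proof -
  have "(\<integral>t. \<theta> (s - t) \<partial>iv T) = X (s - T) - X (s - 0)"
  proof (rule integral_iv_FTC[OF assms])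
    show "((\<lambda>t. X (s - t)) has_real_derivative \<theta> (s - x)) (at x)" for x
      using DERIV_shift_right[OF time_kernel_DERIV(1), of s x] by simp
    show "continuous_on UNIV (\<lambda>t. \<theta> (s - t))"
      by (rule has_real_derivative_imp_continuous_on[OF DERIV_shift_right[OF time_kernel_DERIV(2)]])
  qed
  then show ?thesis by simp
qed

end

context
  fixes d W \<omega> \<omega>'
  assumes sk: "space_kernel d W \<omega> \<omega>'"
begin

lemma space_kernel_DERIV:
  "(W has_real_derivative \<omega> x) (at x)" "(\<omega> has_real_derivative \<omega>' x) (at x)"
  using sk by (simp_all add: space_kernel_def)

lemma space_kernel_pos: "0 \<le> \<omega> x"
  using sk by (simp add: space_kernel_def)

lemma space_kernel_support: "\<omega> x \<noteq> 0 \<Longrightarrow> \<exists>k::int. \<bar>x - k\<bar> < d"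
  using sk unfolding space_kernel_def by blast

lemma space_kernel_bdd: "bdd_meas borel \<omega>" "bdd_meas borel \<omega>'"
proof -
  have "continuous_on UNIV \<omega>"
    using sk by (intro has_real_derivative_imp_continuous_on) (auto simp: space_kernel_def)
  then show "bdd_meas borel \<omega>"
    by (rule bdd_meas_periodic) (use sk in \<open>auto simp: space_kernel_def\<close>)
  show "bdd_meas borel \<omega>'"
    by (rule bdd_meas_periodic) (use sk in \<open>auto simp: space_kernel_def\<close>)
qed

lemma integral_space_kernel_fst: "(\<integral>x. \<omega> (x - y) \<partial>iv 1) = 1"
proof -
  have "(\<integral>x. \<omega> (x - y) \<partial>iv 1) = W (1 - y) - W (0 - y)"
  proof (rule integral_iv_FTC)
    show "((\<lambda>s. W (s - y)) has_real_derivative \<omega> (x - y)) (at x)" for x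
      by (rule DERIV_shift_left[OF space_kernel_DERIV(1)])
    show "continuous_on UNIV (\<lambda>s. \<omega> (s - y))"
      by (rule has_real_derivative_imp_continuous_on[OF DERIV_shift_left[OF space_kernel_DERIV(2)]])
  qed simp
  also have "W (1 - y) = W (0 - y) + 1"
    using sk by (metis space_kernel_def add.commute add_diff_eq diff_0_right add_0 diff_add_eq)
  finally show ?thesis by simp
qed

lemma integral_space_kernel_snd: "(\<integral>y. \<omega> (x - y) \<partial>iv 1) = 1"
proof -
  have "(\<integral>y. \<omega> (x - y) \<partial>iv 1) = - W (x - 1) - (- W (x - 0))"
  proof (rule integral_iv_FTC)
    show "((\<lambda>y. - W (x - y)) has_real_derivative \<omega> (x - y)) (at y)" for y
      using DERIV_minus[OF DERIV_shift_right[OF space_kernel_DERIV(1), of x y]] by simp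
    show "continuous_on UNIV (\<lambda>y. \<omega> (x - y))"
      by (rule has_real_derivative_imp_continuous_on[OF DERIV_shift_right[OF space_kernel_DERIV(2)]])
  qed simp
  also have "W (x - 0) = W (x - 1) + 1"
    using sk by (metis space_kernel_def diff_add_cancel diff_0_right)
  finally show ?thesis by simp
qed

end

subsection \<open>Mollification errors\<close>

text \<open>A measurable function is an almost everywhere limit of continuous ones. Clamping these
  to the bound of f permits dominated convergence and also provides the uniform bound on g that
  \<open>torus_modulus\<close> needs near the ends of the unit interval. The hypothesis
  \<open>ac\<close> is absolute continuity of M.\<close>

lemma L1_continuous_approx:
  fixes f :: "'a::euclidean_space \<Rightarrow> real"
  assumes "finite_measure M" and sets: "sets M = sets borel"
    and ac: "\<And>P. AE x in lborel. P x \<Longrightarrow> AE x in M. P x"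
    and f: "bdd_meas borel f" and "0 < \<kappa>"
  obtains g B where "continuous_on UNIV g" "0 \<le> B" "\<And>x. \<bar>g x\<bar> \<le> B" "(\<integral>x. \<bar>f x - g x\<bar> \<partial>M) < \<kappa>"
proof -
  interpret finite_measure M by fact
  note [measurable_cong] = sets
  obtain B where fm [measurable]: "f \<in> borel_measurable borel" and B: "0 \<le> B" "\<And>x. \<bar>f x\<bar> \<le> B"
    using f by (elim bdd_measE) simp
  have "f \<in> borel_measurable lebesgue" by (simp add: measurable_completion)
  then have "f measurable_on UNIV" by (intro lebesgue_measurable_imp_measurable_on) auto
  then obtain N h where N: "negligible N" and h: "\<And>n. continuous_on UNIV (h n)"
    and lim: "\<And>x. x \<notin> N \<Longrightarrow> (\<lambda>n. h n x) \<longlonglongrightarrow> f x"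
    by (auto simp: measurable_on_def)
  define g where "g n x = max (- B) (min B (h n x))" for n x
  have g: "continuous_on UNIV (g n)" for n
    unfolding g_def by (intro continuous_intros h)
  have [measurable]: "g n \<in> borel_measurable borel" for n
    using g by (rule borel_measurable_continuous_onI)
  have gB: "\<bar>g n x\<bar> \<le> B" for n x using B(1) by (auto simp: g_def)
  have lim_g: "(\<lambda>n. g n x) \<longlonglongrightarrow> f x" if "x \<notin> N" for x
  proof -
    have "(\<lambda>n. g n x) \<longlonglongrightarrow> max (- B) (min B (f x))"
      unfolding g_def by (intro tendsto_intros lim that)
    also have "max (- B) (min B (f x)) = f x" using B(2)[of x] by auto
    finally show ?thesis .
  qed
  have "AE x in lebesgue. x \<notin> N"
    using N by (simp add: negligible_iff_null_sets AE_not_in)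
  then have "AE x in lborel. x \<notin> N" by (simp add: AE_completion_iff)
  then have "AE x in M. x \<notin> N" by (rule ac)
  then have lim_AE: "AE x in M. (\<lambda>n. \<bar>f x - g n x\<bar>) \<longlonglongrightarrow> 0"
  proof eventually_elim
    case (elim x)
    have "(\<lambda>n. f x - g n x) \<longlonglongrightarrow> f x - f x" by (intro tendsto_intros lim_g elim)
    then show ?case using tendsto_rabs_zero by fastforce
  qed
  have "(\<lambda>n. \<integral>x. \<bar>f x - g n x\<bar> \<partial>M) \<longlonglongrightarrow> (\<integral>x. 0 \<partial>M)"
  proof (rule integral_dominated_convergence[where w = "\<lambda>_. 2 * B"])
    show "AE x in M. norm \<bar>f x - g n x\<bar> \<le> 2 * B" for n
    proof (rule AE_I2)
      fix x show "norm \<bar>f x - g n x\<bar> \<le> 2 * B" using B(2)[of x] gB[of n x] by simp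
    qed
  qed (use lim_AE in auto)
  then have "\<forall>\<^sub>F n in sequentially. (\<integral>x. \<bar>f x - g n x\<bar> \<partial>M) < \<kappa>"
    using \<open>0 < \<kappa>\<close> by (intro order_tendstoD) auto
  then obtain n where "(\<integral>x. \<bar>f x - g n x\<bar> \<partial>M) < \<kappa>"
    by (auto simp: eventually_sequentially)
  then show ?thesis using that[of "g n" B] g gB B(1) by blast
qed

text \<open>Integrating out the second variable first leaves \<phi> times a marginal of J, which is
  at most 1.\<close>

lemma integral_fst_kernel_le:
  assumes M: "finite_measure M" and J: "bdd_meas (M \<Otimes>\<^sub>M M) J" "\<And>z. 0 \<le> J z"
    and marg: "AE p in M. (\<integral>q. J (p, q) \<partial>M) \<le> 1" and \<phi>: "bdd_meas M \<phi>" "\<And>p. 0 \<le> \<phi> p"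
  shows "(\<integral>z. \<phi> (fst z) * J z \<partial>(M \<Otimes>\<^sub>M M)) \<le> (\<integral>p. \<phi> p \<partial>M)"
proof -
  interpret finite_measure M by fact
  have b: "bdd_meas (M \<Otimes>\<^sub>M M) (\<lambda>z. \<phi> (fst z) * J z)"
    by (intro bdd_meas_mult J bdd_meas_comp[OF \<phi>(1)]) measurable
  have "(\<integral>z. \<phi> (fst z) * J z \<partial>(M \<Otimes>\<^sub>M M)) = (\<integral>p. \<integral>q. \<phi> p * J (p, q) \<partial>M \<partial>M)"
    using integral_pair_fst[OF M M b] by simp
  also have "\<dots> \<le> (\<integral>p. \<phi> p \<partial>M)"
  proof (rule integral_mono_AE)
    show "integrable M (\<lambda>p. \<integral>q. \<phi> p * J (p, q) \<partial>M)"
      using bdd_meas_integrable[OF bdd_meas_integral[OF b]] by simp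
    show "AE p in M. (\<integral>q. \<phi> p * J (p, q) \<partial>M) \<le> \<phi> p"
      using marg by eventually_elim (simp add: mult_left_le \<phi>(2))
  qed (rule bdd_meas_integrable[OF \<phi>(1)])
  finally show ?thesis .
qed

lemma integral_snd_kernel_le:
  assumes M: "finite_measure M" and J: "bdd_meas (M \<Otimes>\<^sub>M M) J" "\<And>z. 0 \<le> J z"
    and marg: "AE q in M. (\<integral>p. J (p, q) \<partial>M) \<le> 1" and \<phi>: "bdd_meas M \<phi>" "\<And>p. 0 \<le> \<phi> p"
  shows "(\<integral>z. \<phi> (snd z) * J z \<partial>(M \<Otimes>\<^sub>M M)) \<le> (\<integral>p. \<phi> p \<partial>M)"
proof -
  interpret finite_measure M by fact
  have b: "bdd_meas (M \<Otimes>\<^sub>M M) (\<lambda>z. \<phi> (snd z) * J z)"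
    by (intro bdd_meas_mult J bdd_meas_comp[OF \<phi>(1)]) measurable
  have b': "bdd_meas (M \<Otimes>\<^sub>M M) (\<lambda>z. \<phi> (fst z) * J (snd z, fst z))"
    using bdd_meas_comp[OF b, of "\<lambda>z. (snd z, fst z)" "M \<Otimes>\<^sub>M M"] by simp
  have "(\<integral>z. \<phi> (snd z) * J z \<partial>(M \<Otimes>\<^sub>M M)) = (\<integral>q. \<integral>p. \<phi> q * J (p, q) \<partial>M \<partial>M)"
    using integral_pair_snd[OF M M b] by simp
  also have "\<dots> \<le> (\<integral>p. \<phi> p \<partial>M)"
  proof (rule integral_mono_AE)
    show "integrable M (\<lambda>q. \<integral>p. \<phi> q * J (p, q) \<partial>M)"
      using bdd_meas_integrable[OF bdd_meas_integral[OF b']] by simp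
    show "AE q in M. (\<integral>p. \<phi> q * J (p, q) \<partial>M) \<le> \<phi> q"
      using marg by eventually_elim (simp add: mult_left_le \<phi>(2))
  qed (rule bdd_meas_integrable[OF \<phi>(1)])
  finally show ?thesis .
qed

text \<open>Replacing f by g at both points costs their L^1 distance once for each marginal. The
  oscillation of g is bounded by h, and multiplying that hypothesis by J means it only has to be
  checked on the support of the kernel.\<close>

lemma mollification_error:
  assumes M: "finite_measure M" and J: "bdd_meas (M \<Otimes>\<^sub>M M) J" "\<And>z. 0 \<le> J z"
    and marg: "AE p in M. (\<integral>q. J (p, q) \<partial>M) \<le> 1" "AE q in M. (\<integral>p. J (p, q) \<partial>M) \<le> 1"
    and f: "bdd_meas M f" and g: "bdd_meas M g" and h: "bdd_meas M h" "\<And>p. 0 \<le> h p"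
    and gh: "AE z in M \<Otimes>\<^sub>M M. \<bar>g (fst z) - g (snd z)\<bar> * J z \<le> h (fst z) * J z"
  shows "(\<integral>z. \<bar>f (fst z) - f (snd z)\<bar> * J z \<partial>(M \<Otimes>\<^sub>M M)) \<le> 2 * (\<integral>p. \<bar>f p - g p\<bar> \<partial>M) + (\<integral>p. h p \<partial>M)"
proof -
  interpret M: finite_measure M by fact
  interpret P: finite_measure "M \<Otimes>\<^sub>M M" by (rule finite_measure_pair_measure; fact)
  let ?r = "\<lambda>p. \<bar>f p - g p\<bar>"
  have r: "bdd_meas M ?r" by (intro bdd_meas_abs bdd_meas_diff f g)
  have lift: "bdd_meas (M \<Otimes>\<^sub>M M) (\<lambda>z. k (fst z))" "bdd_meas (M \<Otimes>\<^sub>M M) (\<lambda>z. k (snd z))"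
    if "bdd_meas M k" for k
    by (intro bdd_meas_comp[OF that]; simp)+
  note int = P.bdd_meas_integrable bdd_meas_mult bdd_meas_add bdd_meas_abs bdd_meas_diff J(1) lift
  have "(\<integral>z. \<bar>f (fst z) - f (snd z)\<bar> * J z \<partial>(M \<Otimes>\<^sub>M M)) \<le>
      (\<integral>z. ?r (fst z) * J z + ?r (snd z) * J z + h (fst z) * J z \<partial>(M \<Otimes>\<^sub>M M))"
  proof (rule integral_mono_AE)
    show "AE z in M \<Otimes>\<^sub>M M. \<bar>f (fst z) - f (snd z)\<bar> * J z \<le> ?r (fst z) * J z + ?r (snd z) * J z + h (fst z) * J z"
      using gh
    proof eventually_elim
      case (elim z)
      have "\<bar>f (fst z) - f (snd z)\<bar> * J z \<le> (?r (fst z) + ?r (snd z) + \<bar>g (fst z) - g (snd z)\<bar>) * J z"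
        by (rule mult_right_mono[OF _ J(2)]) arith
      with elim show ?case by (simp add: algebra_simps)
    qed
  qed (intro int f r h)+
  also have "\<dots> = (\<integral>z. ?r (fst z) * J z \<partial>(M \<Otimes>\<^sub>M M)) + (\<integral>z. ?r (snd z) * J z \<partial>(M \<Otimes>\<^sub>M M))
      + (\<integral>z. h (fst z) * J z \<partial>(M \<Otimes>\<^sub>M M))"
    by (subst Bochner_Integration.integral_add, (intro int f r h Bochner_Integration.integrable_add)+)+ simp
  also have "\<dots> \<le> (\<integral>p. ?r p \<partial>M) + (\<integral>p. ?r p \<partial>M) + (\<integral>p. h p \<partial>M)"
    by (intro add_mono integral_fst_kernel_le[OF M J marg(1)] integral_snd_kernel_le[OF M J marg(2)] r h) auto
  finally show ?thesis by simp
qed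

lemma measure_iv_le:
  assumes "A \<in> sets borel" "{0..T} \<inter> A \<subseteq> {a..b}" "a \<le> b"
  shows "measure (iv T) A \<le> b - a"
proof -
  have "emeasure (iv T) A = emeasure lborel ({0..T} \<inter> A)"
    using assms(1) by (simp add: iv_def emeasure_density Int_commute flip: indicator_inter_arith)
  also have "\<dots> \<le> emeasure lborel {a..b}"
    using assms by (intro emeasure_mono) auto
  finally have "emeasure (iv T) A \<le> ennreal (b - a)" using assms(3) by simp
  then show ?thesis
    using assms(3) by (simp add: measure_def enn2real_leI)
qed

text \<open>The indicator terms pay for points that are close on the torus but far apart in the unit interval.\<close>

lemma torus_modulus:
  fixes g :: "real \<times> real \<Rightarrow> real" and T :: real
  assumes "continuous_on UNIV g" "0 \<le> B" "\<And>p. \<bar>g p\<bar> \<le> B" "0 < \<kappa>"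
  shows "\<exists>d0>0. \<forall>d<d0. \<forall>x\<in>{0..1::real}. \<forall>y\<in>{0..1::real}. \<forall>t\<in>{0..T}. \<forall>s\<in>{0..T}.
      \<bar>s - t\<bar> < d0 \<longrightarrow> (\<exists>k::int. \<bar>x - y - k\<bar> < d) \<longrightarrow>
      \<bar>g (x, t) - g (y, s)\<bar> \<le> \<kappa> + 2 * B * (indicator {..d} x + indicator {1 - d..} x)"
proof -
  have "compact ({0..1} \<times> {0..T} :: (real \<times> real) set)" by (intro compact_Times) auto
  then have "uniformly_continuous_on ({0..1} \<times> {0..T}) g"
    using assms(1) by (intro compact_uniformly_continuous) (auto intro: continuous_on_subset)
  then have "\<exists>r>0. \<forall>p\<in>{0..1} \<times> {0..T}. \<forall>q\<in>{0..1} \<times> {0..T}. dist q p < r \<longrightarrow> dist (g q) (g p) < \<kappa>"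
    unfolding uniformly_continuous_on_def using assms(4) by simp
  then obtain r where r: "0 < r" "\<And>p q. p \<in> {0..1} \<times> {0..T} \<Longrightarrow> q \<in> {0..1} \<times> {0..T} \<Longrightarrow>
      dist q p < r \<Longrightarrow> dist (g q) (g p) < \<kappa>"
    by (elim exE conjE) (rule that, auto)
  \<comment> \<open>The distance r is split evenly between space and time.\<close>
  define d0 where "d0 = min (r / 2) 1"
  show ?thesis
  proof (intro exI[of _ d0] conjI allI ballI impI)
    show "0 < d0" using r by (simp add: d0_def)
    fix d x y t s :: real
    assume A: "d < d0" "x \<in> {0..1}" "y \<in> {0..1}" "t \<in> {0..T}" "s \<in> {0..T}" "\<bar>s - t\<bar> < d0"
      and "\<exists>k::int. \<bar>x - y - k\<bar> < d"
    then obtain k :: int where k: "\<bar>x - y - k\<bar> < d" by blast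
    show "\<bar>g (x, t) - g (y, s)\<bar> \<le> \<kappa> + 2 * B * (indicator {..d} x + indicator {1 - d..} x)"
    proof (cases "k = 0")
      case True
      have "dist (x, t) (y, s) \<le> \<bar>x - y\<bar> + \<bar>t - s\<bar>"
        unfolding dist_prod_def dist_real_def using sqrt_sum_squares_le_sum_abs[of "x - y" "t - s"] by simp
      also have "\<dots> < r"
      proof -
        have "d0 \<le> r / 2" by (simp add: d0_def)
        then show ?thesis using True k A(1,6) by simp
      qed
      finally have "dist (g (x, t)) (g (y, s)) < \<kappa>"
        using r(2)[of "(y, s)" "(x, t)"] A by simp
      then have "\<bar>g (x, t) - g (y, s)\<bar> \<le> \<kappa>" by (simp add: dist_real_def)
      moreover have "0 \<le> 2 * B * (indicator {..d} x + indicator {1 - d..} x)"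
        using assms(2) by simp
      ultimately show ?thesis by linarith
    next
      case False
      \<comment> \<open>With x and y in the unit interval, a nonzero k puts them near opposite ends,
        so x lies in one of the two boundary layers.\<close>
      then have "k \<le> -1 \<or> 1 \<le> k" by linarith
      then have "real_of_int k \<le> -1 \<or> 1 \<le> real_of_int k" by linarith
      then have "x \<le> d \<or> 1 - d \<le> x" using k A(2,3) by auto
      then have "1 \<le> (indicator {..d} x + indicator {1 - d..} x :: real)"
        by (auto simp: indicator_def)
      then have "2 * B * 1 \<le> 2 * B * (indicator {..d} x + indicator {1 - d..} x)"
        using assms(2) by (intro mult_left_mono) auto
      moreover have "\<bar>g (x, t) - g (y, s)\<bar> \<le> 2 * B"
        using assms(3)[of "(x, t)"] assms(3)[of "(y, s)"] by linarith
      ultimately show ?thesis using assms(4) by linarith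
    qed
  qed
qed

lemma bdd_meas_indicator [intro]: "A \<in> sets M \<Longrightarrow> bdd_meas M (indicator A)"
  by (rule bdd_measI[of _ _ 1]) (auto simp: indicator_def)

lemma boundary_layer_integral:
  assumes "0 < d" "d < 1" "0 \<le> B" "0 \<le> c"
  shows "(\<integral>x. c + 2 * B * (indicator {..d} x + indicator {1 - d..} x) \<partial>iv 1) \<le> c + 4 * B * d"
proof -
  interpret finite_measure "iv 1" by simp
  have "(\<integral>x. c + 2 * B * (indicator {..d} x + indicator {1 - d..} x) \<partial>iv 1)
      = c + 2 * B * (measure (iv 1) {..d} + measure (iv 1) {1 - d..})"
  proof -
    have "integrable (iv 1) (indicator A :: real \<Rightarrow> real)" if "A \<in> sets borel" for A
      by (rule bdd_meas_integrable) (use that in auto)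
    then show ?thesis by (simp add: measure_iv[of 1, simplified])
  qed
  also have "\<dots> \<le> c + 2 * B * ((d - 0) + (1 - (1 - d)))"
    by (intro add_left_mono mult_left_mono add_mono measure_iv_le) (use assms in auto)
  finally show ?thesis by simp
qed

lemma bdd_meas_iv: "bdd_meas borel f \<Longrightarrow> bdd_meas (iv T) f"
  using bdd_meas_cong_sets[OF sets_iv] by blast

lemma bdd_meas_slab: "bdd_meas borel f \<Longrightarrow> bdd_meas (slab T) f"
  using bdd_meas_cong_sets[OF sets_slab] by blast

text \<open>P and Q need not define measurable sets, so Fubini is applied to the complements of
  measurable null sets covering their exceptional points.\<close>

lemma AE_pair_fst_snd:
  assumes "finite_measure M" "finite_measure N" "AE x in M. P x" "AE y in N. Q y"
  shows "AE z in M \<Otimes>\<^sub>M N. P (fst z) \<and> Q (snd z)"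
proof -
  interpret M: finite_measure M by fact
  interpret N: finite_measure N by fact
  interpret pair_sigma_finite M N ..
  obtain A where A: "{x \<in> space M. \<not> P x} \<subseteq> A" "A \<in> null_sets M"
    using assms(3) by (auto elim: AE_E simp: null_sets_def)
  obtain C where C: "{x \<in> space N. \<not> Q x} \<subseteq> C" "C \<in> null_sets N"
    using assms(4) by (auto elim: AE_E simp: null_sets_def)
  have [measurable]: "A \<in> sets M" "C \<in> sets N"
    using A(2) C(2) by (auto simp: null_sets_def)
  have "AE x in M. AE y in N. (\<lambda>z. fst z \<notin> A \<and> snd z \<notin> C) (x, y)"
    using AE_not_in[OF A(2)] by eventually_elim (use AE_not_in[OF C(2)] in eventually_elim, simp)
  moreover have "{z \<in> space (M \<Otimes>\<^sub>M N). fst z \<notin> A \<and> snd z \<notin> C} \<in> sets (M \<Otimes>\<^sub>M N)"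
    by measurable
  ultimately have "AE z in M \<Otimes>\<^sub>M N. fst z \<notin> A \<and> snd z \<notin> C"
    by (rule AE_pair_measure[rotated])
  then show ?thesis
    using AE_space by eventually_elim (use A C in \<open>auto simp: space_pair_measure\<close>)
qed

text \<open>The threshold works for all kernels of smaller width at once, because only their support
  and their marginals enter the estimate.\<close>

lemma mollification_error_space:
  assumes f: "bdd_meas borel f" and "0 < \<kappa>"
  obtains d0 where "0 < d0"
    "\<And>d W \<omega> \<omega>'. 0 < d \<Longrightarrow> d < d0 \<Longrightarrow> space_kernel d W \<omega> \<omega>' \<Longrightarrow>
      (\<integral>z. \<bar>f (fst z) - f (snd z)\<bar> * \<omega> (fst z - snd z) \<partial>(iv 1 \<Otimes>\<^sub>M iv 1)) \<le> \<kappa>"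
proof -
  obtain g B where g: "continuous_on UNIV g" "0 \<le> B" "\<And>x. \<bar>g x\<bar> \<le> B" "(\<integral>x. \<bar>f x - g x\<bar> \<partial>iv 1) < \<kappa> / 4"
  proof (rule L1_continuous_approx[OF finite_measure_iv sets_iv _ f, of 1 "\<kappa> / 4"])
    show "AE x in iv 1. P x" if "AE x in lborel. P x" for P
      using that by (auto simp: AE_iv_iff elim: eventually_mono)
  qed (use assms(2) in auto)
  have cont: "continuous_on UNIV (\<lambda>p :: real \<times> real. g (fst p))"
    by (intro continuous_on_compose2[OF g(1)] continuous_intros) auto
  \<comment> \<open>The degenerate time interval {0..0} lets the space-time modulus serve a function
    of x alone.\<close>
  have "\<exists>d0>0. \<forall>d<d0. \<forall>x\<in>{0..1::real}. \<forall>y\<in>{0..1::real}. \<forall>t\<in>{0..0::real}. \<forall>s\<in>{0..0::real}.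
      \<bar>s - t\<bar> < d0 \<longrightarrow> (\<exists>k::int. \<bar>x - y - k\<bar> < d) \<longrightarrow>
      \<bar>g (fst (x, t)) - g (fst (y, s))\<bar> \<le> \<kappa> / 4 + 2 * B * (indicator {..d} x + indicator {1 - d..} x)"
    by (rule torus_modulus) (use cont g(2,3) assms(2) in auto)
  then obtain d0 where d0: "0 < d0" "\<forall>d<d0. \<forall>x\<in>{0..1::real}. \<forall>y\<in>{0..1::real}. \<forall>t\<in>{0..0::real}. \<forall>s\<in>{0..0::real}.
      \<bar>s - t\<bar> < d0 \<longrightarrow> (\<exists>k::int. \<bar>x - y - k\<bar> < d) \<longrightarrow>
      \<bar>g x - g y\<bar> \<le> \<kappa> / 4 + 2 * B * (indicator {..d} x + indicator {1 - d..} x)"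
    by (simp only: fst_conv) (elim exE conjE that)
  \<comment> \<open>The approximation errors and the modulus of g use up three quarters of \<kappa>;
    this width makes the boundary layers, \<open>4 * B * d\<close>, cost at most the last quarter.
    Adding 1 to B avoids division by zero.\<close>
  define d1 where "d1 = Min {d0, 1, \<kappa> / (16 * (B + 1))}"
  show ?thesis
  proof (rule that[of d1])
    show "0 < d1" using d0 g assms(2) by (simp add: d1_def)
    fix d W \<omega> \<omega>'
    assume d: "0 < d" "d < d1" and sk: "space_kernel d W \<omega> \<omega>'"
    have d': "d < d0" "d < 1" "d * (16 * (B + 1)) < \<kappa>"
      using d g(2) by (auto simp: d1_def pos_less_divide_eq)
    let ?h = "\<lambda>x. \<kappa> / 4 + 2 * B * (indicator {..d} x + indicator {1 - d..} x)"
    have "(\<integral>z. \<bar>f (fst z) - f (snd z)\<bar> * \<omega> (fst z - snd z) \<partial>(iv 1 \<Otimes>\<^sub>M iv 1))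
        \<le> 2 * (\<integral>p. \<bar>f p - g p\<bar> \<partial>iv 1) + (\<integral>p. ?h p \<partial>iv 1)"
    proof (rule mollification_error)
      show "bdd_meas (iv 1 \<Otimes>\<^sub>M iv 1) (\<lambda>z. \<omega> (fst z - snd z))"
        by (rule bdd_meas_comp[OF space_kernel_bdd(1)[OF sk]]) measurable
      show "0 \<le> \<omega> (fst z - snd z)" for z by (rule space_kernel_pos[OF sk])
      show "AE p in iv 1. (\<integral>q. \<omega> (fst (p, q) - snd (p, q)) \<partial>iv 1) \<le> 1"
        by (simp add: integral_space_kernel_snd[OF sk])
      show "AE q in iv 1. (\<integral>p. \<omega> (fst (p, q) - snd (p, q)) \<partial>iv 1) \<le> 1"
        by (simp add: integral_space_kernel_fst[OF sk])
      show "bdd_meas (iv 1) f" by (rule bdd_meas_iv[OF f])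
      show "bdd_meas (iv 1) g"
        using g(3) by (intro bdd_meas_iv bdd_measI borel_measurable_continuous_onI g(1))
      show "bdd_meas (iv 1) ?h"
        by (intro bdd_meas_add bdd_meas_mult bdd_meas_const bdd_meas_indicator) auto
      show "0 \<le> ?h p" for p using g(2) assms(2) by simp
      have "AE z in iv 1 \<Otimes>\<^sub>M iv 1. fst z \<in> {0..1} \<and> snd z \<in> {0..1}"
        by (intro AE_pair_fst_snd AE_iv finite_measure_iv)
      then show "AE z in iv 1 \<Otimes>\<^sub>M iv 1. \<bar>g (fst z) - g (snd z)\<bar> * \<omega> (fst z - snd z)
          \<le> ?h (fst z) * \<omega> (fst z - snd z)"
      proof eventually_elim
        case (elim z)
        show ?case
        proof (cases "\<omega> (fst z - snd z) = 0")
          case False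
          then have "\<exists>k::int. \<bar>fst z - snd z - k\<bar> < d" by (rule space_kernel_support[OF sk])
          then have "\<bar>g (fst z) - g (snd z)\<bar> \<le> ?h (fst z)"
            using d0(2)[rule_format, of d "fst z" "snd z" 0 0] elim d' d0(1) by auto
          then show ?thesis by (rule mult_right_mono) (rule space_kernel_pos[OF sk])
        qed simp
      qed
    qed simp
    also have "\<dots> \<le> 2 * (\<kappa> / 4) + (\<kappa> / 4 + 4 * B * d)"
      using boundary_layer_integral[of d B "\<kappa> / 4"] g d d' assms(2) by (intro add_mono) auto
    also have "\<dots> \<le> \<kappa>" using d' d g(2) by (simp add: algebra_simps)
    finally show "(\<integral>z. \<bar>f (fst z) - f (snd z)\<bar> * \<omega> (fst z - snd z) \<partial>(iv 1 \<Otimes>\<^sub>M iv 1)) \<le> \<kappa>" .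
  qed
qed

section \<open>The space-time kernel and its marginals\<close>

definition st_kernel :: "(real \<Rightarrow> real) \<Rightarrow> (real \<Rightarrow> real) \<Rightarrow> (real \<times> real) \<times> (real \<times> real) \<Rightarrow> real" where
  "st_kernel \<omega> \<theta> z = \<omega> (fst (fst z) - fst (snd z)) * \<theta> (snd (snd z) - snd (fst z))"

lemma slab_integral_product:
  assumes "bdd_meas borel a" "bdd_meas borel b"
  shows "(\<integral>p. a (fst p) * b (snd p) \<partial>slab T) = (\<integral>x. a x \<partial>iv 1) * (\<integral>t. b t \<partial>iv T)"
proof -
  have "bdd_meas (slab T) (\<lambda>p. a (fst p) * b (snd p))"
    by (intro bdd_meas_mult bdd_meas_comp[OF assms(1)] bdd_meas_comp[OF assms(2)]) measurable
  from integral_pair_fst[OF finite_measure_iv finite_measure_iv this] show ?thesis by simp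
qed

context
  fixes T d e :: real and W \<omega> \<omega>' X \<theta> \<theta>'
  assumes T: "0 < T" and sk: "space_kernel d W \<omega> \<omega>'" and tk: "time_kernel e X \<theta> \<theta>'"
begin

lemma st_kernel_bdd: "bdd_meas (slab T \<Otimes>\<^sub>M slab T) (st_kernel \<omega> \<theta>)"
  unfolding st_kernel_def
  by (intro bdd_meas_mult bdd_meas_comp[OF space_kernel_bdd(1)[OF sk]]
      bdd_meas_comp[OF time_kernel_bdd(1)[OF tk]]) measurable

lemma st_kernel_nonneg: "0 \<le> st_kernel \<omega> \<theta> z"
  by (simp add: st_kernel_def space_kernel_pos[OF sk] time_kernel_pos[OF tk])

lemma st_kernel_integral_snd:
  "(\<integral>q. st_kernel \<omega> \<theta> (p, q) \<partial>slab T) = X (- snd p) - X (T - snd p)"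
proof -
  have "(\<integral>q. \<omega> (fst p - fst q) * \<theta> (snd q - snd p) \<partial>slab T)
      = (\<integral>y. \<omega> (fst p - y) \<partial>iv 1) * (\<integral>s. \<theta> (s - snd p) \<partial>iv T)"
    by (intro slab_integral_product bdd_meas_comp[OF space_kernel_bdd(1)[OF sk]]
        bdd_meas_comp[OF time_kernel_bdd(1)[OF tk]]) measurable
  then show ?thesis
    using T by (simp add: st_kernel_def integral_space_kernel_snd[OF sk] integral_time_kernel_fst[OF tk])
qed

lemma st_kernel_integral_fst:
  "(\<integral>p. st_kernel \<omega> \<theta> (p, q) \<partial>slab T) = X (snd q - T) - X (snd q)"
proof -
  have "(\<integral>p. \<omega> (fst p - fst q) * \<theta> (snd q - snd p) \<partial>slab T)
      = (\<integral>x. \<omega> (x - fst q) \<partial>iv 1) * (\<integral>t. \<theta> (snd q - t) \<partial>iv T)"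
    by (intro slab_integral_product bdd_meas_comp[OF space_kernel_bdd(1)[OF sk]]
        bdd_meas_comp[OF time_kernel_bdd(1)[OF tk]]) measurable
  then show ?thesis
    using T by (simp add: st_kernel_def integral_space_kernel_fst[OF sk] integral_time_kernel_snd[OF tk])
qed

lemma st_kernel_marginals:
  "(\<integral>q. st_kernel \<omega> \<theta> (p, q) \<partial>slab T) \<le> 1" "(\<integral>p. st_kernel \<omega> \<theta> (p, q) \<partial>slab T) \<le> 1"
  unfolding st_kernel_integral_snd st_kernel_integral_fst
  using time_kernel_nonneg[OF tk] time_kernel_le_1[OF tk]
  by (smt (verit))+

text \<open>At these times the support of \<theta> (s - t) as a function of s stays inside the time
  interval, so no mass is lost at the final time T.\<close>

lemma st_kernel_marginal_eq:
  assumes "0 \<le> snd p" "snd p \<le> T - e"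
  shows "(\<integral>q. st_kernel \<omega> \<theta> (p, q) \<partial>slab T) = 1"
  unfolding st_kernel_integral_snd using assms tk by (simp add: time_kernel_def)

end

text \<open>Both widths have to be small, but no relation between d and e is imposed; this freedom
  allows e to be chosen after d.\<close>

lemma mollification_error_space_time:
  assumes f: "bdd_meas borel f" and T: "0 < T" and "0 < \<kappa>"
  obtains d0 where "0 < d0"
    "\<And>d W \<omega> \<omega>' e X \<theta> \<theta>'. 0 < d \<Longrightarrow> d < d0 \<Longrightarrow> e < d0 \<Longrightarrow> space_kernel d W \<omega> \<omega>' \<Longrightarrow> time_kernel e X \<theta> \<theta>' \<Longrightarrow>
      (\<integral>z. \<bar>f (fst z) - f (snd z)\<bar> * st_kernel \<omega> \<theta> z \<partial>(slab T \<Otimes>\<^sub>M slab T)) \<le> \<kappa>"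
proof -
  obtain g B where g: "continuous_on UNIV g" "0 \<le> B" "\<And>x. \<bar>g x\<bar> \<le> B"
    "(\<integral>x. \<bar>f x - g x\<bar> \<partial>slab T) < \<kappa> / 4"
  proof (rule L1_continuous_approx[OF finite_measure_slab sets_slab _ f, of T "\<kappa> / 4"])
    show "AE z in slab T. P z" if "AE z in lborel. P z" for P
      by (rule AE_slabI) (use that in eventually_elim, simp)
  qed (use assms(3) in auto)
  have "\<exists>d0>0. \<forall>d<d0. \<forall>x\<in>{0..1::real}. \<forall>y\<in>{0..1::real}. \<forall>t\<in>{0..T}. \<forall>s\<in>{0..T}.
      \<bar>s - t\<bar> < d0 \<longrightarrow> (\<exists>k::int. \<bar>x - y - k\<bar> < d) \<longrightarrow>
      \<bar>g (x, t) - g (y, s)\<bar> \<le> \<kappa> / (4 * T) + 2 * B * (indicator {..d} x + indicator {1 - d..} x)"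
    by (rule torus_modulus) (use g assms(2,3) in auto)
  then obtain d0 where d0: "0 < d0" "\<forall>d<d0. \<forall>x\<in>{0..1::real}. \<forall>y\<in>{0..1::real}. \<forall>t\<in>{0..T}. \<forall>s\<in>{0..T}.
      \<bar>s - t\<bar> < d0 \<longrightarrow> (\<exists>k::int. \<bar>x - y - k\<bar> < d) \<longrightarrow>
      \<bar>g (x, t) - g (y, s)\<bar> \<le> \<kappa> / (4 * T) + 2 * B * (indicator {..d} x + indicator {1 - d..} x)"
    by (elim exE conjE that)
  \<comment> \<open>The budget is the same as in the purely spatial case; the factor T appears
    because the slab has length T in time, for which the modulus of g was also divided by T.\<close>
  define d1 where "d1 = Min {d0, 1, \<kappa> / (16 * (B + 1) * T)}"
  show ?thesis
  proof (rule that[of d1])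
    show "0 < d1" using d0 g assms(2,3) by (simp add: d1_def)
    fix d W \<omega> \<omega>' e X \<theta> \<theta>'
    assume d: "0 < d" "d < d1" "e < d1" and sk: "space_kernel d W \<omega> \<omega>'" and tk: "time_kernel e X \<theta> \<theta>'"
    have d': "d < d0" "e < d0" "d < 1" "d * (16 * (B + 1) * T) < \<kappa>"
      using d g(2) T by (auto simp: d1_def pos_less_divide_eq)
    let ?h = "\<lambda>x. \<kappa> / (4 * T) + 2 * B * (indicator {..d} x + indicator {1 - d..} x)"
    have h: "bdd_meas borel ?h"
      by (intro bdd_meas_add bdd_meas_mult bdd_meas_const bdd_meas_indicator) auto
    have "(\<integral>z. \<bar>f (fst z) - f (snd z)\<bar> * st_kernel \<omega> \<theta> z \<partial>(slab T \<Otimes>\<^sub>M slab T))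
        \<le> 2 * (\<integral>p. \<bar>f p - g p\<bar> \<partial>slab T) + (\<integral>p. ?h (fst p) \<partial>slab T)"
    proof (rule mollification_error)
      show "bdd_meas (slab T \<Otimes>\<^sub>M slab T) (st_kernel \<omega> \<theta>)"
        by (rule st_kernel_bdd[OF T sk tk])
      show "AE p in slab T. (\<integral>q. st_kernel \<omega> \<theta> (p, q) \<partial>slab T) \<le> 1"
        "AE q in slab T. (\<integral>p. st_kernel \<omega> \<theta> (p, q) \<partial>slab T) \<le> 1"
        by (simp_all add: st_kernel_marginals[OF T sk tk])
      show "bdd_meas (slab T) f" by (rule bdd_meas_slab[OF f])
      show "bdd_meas (slab T) g"
        using g(3) by (intro bdd_meas_slab bdd_measI borel_measurable_continuous_onI g(1))
      show "bdd_meas (slab T) (\<lambda>p. ?h (fst p))"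
        by (rule bdd_meas_comp[OF h]) measurable
      show "0 \<le> ?h (fst p)" for p :: "real \<times> real" using g(2) assms(2,3) by simp
      have "AE z in slab T \<Otimes>\<^sub>M slab T. (fst (fst z) \<in> {0..1} \<and> snd (fst z) \<in> {0..T}) \<and>
          (fst (snd z) \<in> {0..1} \<and> snd (snd z) \<in> {0..T})"
        by (rule AE_pair_fst_snd[OF finite_measure_slab finite_measure_slab AE_slab AE_slab])
      then show "AE z in slab T \<Otimes>\<^sub>M slab T. \<bar>g (fst z) - g (snd z)\<bar> * st_kernel \<omega> \<theta> z
          \<le> ?h (fst (fst z)) * st_kernel \<omega> \<theta> z"
      proof eventually_elim
        case (elim z)
        obtain x t y s where z: "z = ((x, t), (y, s))" by (metis surj_pair)
        show ?case
        proof (cases "st_kernel \<omega> \<theta> z = 0")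
          case False
          then have "\<omega> (x - y) \<noteq> 0" "\<theta> (s - t) \<noteq> 0" by (auto simp: st_kernel_def z)
          then have "\<exists>k::int. \<bar>x - y - k\<bar> < d" "0 < s - t" "s - t < e"
            using space_kernel_support[OF sk] time_kernel_support[OF tk] by blast+
          then have "\<bar>g (x, t) - g (y, s)\<bar> \<le> ?h x"
            using d0(2)[rule_format, of d x y t s] elim d' z by simp
          then have "\<bar>g (fst z) - g (snd z)\<bar> \<le> ?h (fst (fst z))" by (simp add: z)
          then show ?thesis by (rule mult_right_mono) (rule st_kernel_nonneg[OF T sk tk])
        qed simp
      qed
    qed (use st_kernel_nonneg[OF T sk tk] in simp_all)
    also have "(\<integral>p. ?h (fst p) \<partial>slab T) = (\<integral>x. ?h x \<partial>iv 1) * T"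
      using slab_integral_product[OF h bdd_meas_const[of _ 1], of T] T by simp
    also have "2 * (\<integral>p. \<bar>f p - g p\<bar> \<partial>slab T) + \<dots> \<le> 2 * (\<kappa> / 4) + (\<kappa> / (4 * T) + 4 * B * d) * T"
      using boundary_layer_integral[of d B "\<kappa> / (4 * T)"] g d d' assms(2,3)
      by (intro add_mono mult_right_mono) auto
    also have "\<dots> \<le> \<kappa>"
    proof -
      have "0 < d * T" using d T by simp
      then have "16 * (B * d * T) \<le> \<kappa>" using d' by (simp add: algebra_simps)
      then show ?thesis using T by (simp add: field_simps)
    qed
    finally show "(\<integral>z. \<bar>f (fst z) - f (snd z)\<bar> * st_kernel \<omega> \<theta> z \<partial>(slab T \<Otimes>\<^sub>M slab T)) \<le> \<kappa>" .
  qed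
qed

subsection \<open>Doubling of variables\<close>

text \<open>This is Kruzkov's entropy flux sgn (a - b) (a^2 - b^2) / 2 for the Burgers nonlinearity,
  written so that it is visibly symmetric.\<close>

definition flux :: "real \<Rightarrow> real \<Rightarrow> real" where
  "flux a b = \<bar>a - b\<bar> * (a + b) / 2"

lemma flux_commute: "flux a b = flux b a"
  by (simp add: flux_def abs_minus_commute add.commute)

lemma bdd_meas_flux [intro]: "bdd_meas M f \<Longrightarrow> bdd_meas M g \<Longrightarrow> bdd_meas M (\<lambda>x. flux (f x) (g x))"
  unfolding flux_def by (intro bdd_meas_divide bdd_meas_mult bdd_meas_abs bdd_meas_diff bdd_meas_add)

text \<open>Products of a periodic function of x and a compactly supported function of t are enough:
  once one of the two points is frozen, the doubled test function has this form in the
  other.\<close>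

definition product_test :: "(real \<Rightarrow> real) \<Rightarrow> (real \<Rightarrow> real) \<Rightarrow> (real \<Rightarrow> real) \<Rightarrow> (real \<Rightarrow> real) \<Rightarrow> bool" where
  "product_test w w' a a' \<longleftrightarrow>
     (\<forall>x. 0 \<le> w x \<and> w (x + 1) = w x) \<and> (\<forall>x. (w has_real_derivative w' x) (at x)) \<and> continuous_on UNIV w' \<and>
     (\<forall>t. 0 \<le> a t) \<and> (\<forall>t. (a has_real_derivative a' t) (at t)) \<and> continuous_on UNIV a' \<and>
     (\<exists>R. \<forall>t. R < \<bar>t\<bar> \<longrightarrow> a t = 0)"

text \<open>The source \<open>A\<close> does not depend on the constant c. In this form the doubling
  argument is the one for a scalar conservation law with a given bounded source.\<close>

definition entropy_ineq ::
  "real \<Rightarrow> (real \<Rightarrow> real) \<Rightarrow> (real \<times> real \<Rightarrow> real) \<Rightarrow> (real \<times> real \<Rightarrow> real) \<Rightarrow> bool" where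
  "entropy_ineq T U0 U A \<longleftrightarrow> (\<forall>c w w' a a'. product_test w w' a a' \<longrightarrow>
     0 \<le> (\<integral>p. \<bar>U p - c\<bar> * a' (snd p) * w (fst p) + flux (U p) c * a (snd p) * w' (fst p)
              - sgn (U p - c) * A p * a (snd p) * w (fst p) \<partial>slab T)
        + a 0 * (\<integral>x. \<bar>U0 x - c\<bar> * w x \<partial>iv 1))"

lemma entropy_ineqD:
  assumes "entropy_ineq T U0 U A" "product_test w w' a a'"
  shows "0 \<le> (\<integral>p. \<bar>U p - c\<bar> * a' (snd p) * w (fst p) + flux (U p) c * a (snd p) * w' (fst p)
              - sgn (U p - c) * A p * a (snd p) * w (fst p) \<partial>slab T)
        + a 0 * (\<integral>x. \<bar>U0 x - c\<bar> * w x \<partial>iv 1)"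
  using assms unfolding entropy_ineq_def by blast

text \<open>The function X (t - a) equals 1 for all t before a and so lacks compact support. A
  second kernel, reflected in time, switches it off between -1 and 0, where the entropy inequality
  does not look.\<close>

lemma ex_cutoff:
  assumes tk: "time_kernel e X \<theta> \<theta>'" and "0 < e" "0 \<le> a"
  obtains P P' where "\<And>t. 0 \<le> P t" "\<And>t. (P has_real_derivative P' t) (at t)" "continuous_on UNIV P'"
    "\<And>t. t \<notin> {-1..a + e} \<Longrightarrow> P t = 0" "\<And>t. t \<notin> {-1..a + e} \<Longrightarrow> P' t = 0"
    "\<And>t. 0 \<le> t \<Longrightarrow> P t = X (t - a)" "\<And>t. 0 \<le> t \<Longrightarrow> P' t = - \<theta> (t - a)"
proof -
  obtain Y \<zeta> \<zeta>' where tk1: "time_kernel 1 Y \<zeta> \<zeta>'" using ex_time_kernel[of 1] by auto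
  define P P' where "P t = X (t - a) * Y (0 - t)"
    and "P' t = X (t - a) * \<zeta> (0 - t) - \<theta> (t - a) * Y (0 - t)" for t
  have c: "continuous_on UNIV (\<lambda>t. X (t - a))" "continuous_on UNIV (\<lambda>t. \<theta> (t - a))"
    "continuous_on UNIV (\<lambda>t. Y (0 - t))" "continuous_on UNIV (\<lambda>t. \<zeta> (0 - t))"
    by (rule has_real_derivative_imp_continuous_on DERIV_shift_left DERIV_shift_right
        time_kernel_DERIV[OF tk] time_kernel_DERIV[OF tk1])+
  show ?thesis
  proof (rule that[of P P'])
    show "0 \<le> P t" for t
      by (simp add: P_def time_kernel_nonneg[OF tk] time_kernel_nonneg[OF tk1])
    show "(P has_real_derivative P' t) (at t)" for t
      unfolding P_def P'_def
      using DERIV_mult[OF DERIV_shift_left[OF time_kernel_DERIV(1)[OF tk], of a t]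
          DERIV_shift_right[OF time_kernel_DERIV(1)[OF tk1], of 0 t]]
      by (simp add: algebra_simps)
    show "continuous_on UNIV P'"
      unfolding P'_def by (intro continuous_intros c)
    show "P t = 0" "P' t = 0" if outside: "t \<notin> {-1..a + e}" for t
    proof -
      consider "1 \<le> - t" | "e \<le> t - a" "0 \<le> t"
        using outside assms(2,3) by (cases "t < -1") auto
      then show "P t = 0" "P' t = 0"
        using tk tk1 by (cases; simp add: P_def P'_def time_kernel_def)+
    qed
    show "P t = X (t - a)" "P' t = - \<theta> (t - a)" if "0 \<le> t" for t
      using that tk1 by (simp_all add: P_def P'_def time_kernel_def)
  qed
qed

context
  fixes T :: real and U0 V0 :: "real \<Rightarrow> real" and U V A B :: "real \<times> real \<Rightarrow> real" and \<eta> \<eta>' :: "real \<Rightarrow> real"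
  assumes T: "0 < T"
    and bdd: "bdd_meas borel U0" "bdd_meas borel V0" "bdd_meas borel U" "bdd_meas borel V"
      "bdd_meas borel A" "bdd_meas borel B" "bdd_meas borel \<eta>" "bdd_meas borel \<eta>'"
    and ent_U: "entropy_ineq T U0 U A" and ent_V: "entropy_ineq T V0 V B"
    and \<eta>: "\<And>t. 0 \<le> \<eta> t" "\<And>t. (\<eta> has_real_derivative \<eta>' t) (at t)" "continuous_on UNIV \<eta>'"
begin

text \<open>The kernel \<open>\<theta> (s - t)\<close> vanishes for \<open>s \<le> t\<close>, so of the two initial terms only
  \<open>\<bar>U0 x - V (y, s)\<bar>\<close> near \<open>s = 0\<close> survives. It is traced back to \<open>V0\<close> by testing the inequality for \<open>V\<close>
  once more, with the constant \<open>U0 x\<close> and the antiderivative \<open>X\<close> of \<open>- \<theta>\<close>; this costs \<open>C * e\<close>.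
  The flux terms cancel exactly because the test function depends on \<open>x - y\<close> only.\<close>

lemma doubling_inequality:
  fixes d e C :: real
  assumes sk: "space_kernel d W \<omega> \<omega>'" and tk: "time_kernel e X \<theta> \<theta>'" and "0 < e"
    and C: "\<And>x q. \<bar>flux (V q) (U0 x) * \<omega>' (x - fst q)\<bar> + \<bar>B q * \<omega> (x - fst q)\<bar> \<le> C"
  shows "0 \<le> (\<integral>z. \<bar>U (fst z) - V (snd z)\<bar> * \<eta>' (snd (fst z)) * st_kernel \<omega> \<theta> z \<partial>(slab T \<Otimes>\<^sub>M slab T))
      + (\<integral>z. \<bar>A (fst z) - B (snd z)\<bar> * \<eta> (snd (fst z)) * st_kernel \<omega> \<theta> z \<partial>(slab T \<Otimes>\<^sub>M slab T))
      + \<eta> 0 * ((\<integral>z. \<bar>U0 (fst z) - V0 (snd z)\<bar> * \<omega> (fst z - snd z) \<partial>(iv 1 \<Otimes>\<^sub>M iv 1)) + C * e)"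
proof -
  let ?S = "slab T" and ?SS = "slab T \<Otimes>\<^sub>M slab T"
  interpret S: finite_measure ?S by simp
  interpret I: finite_measure "iv 1" by simp
  interpret IT: finite_measure "iv T" by simp
  interpret SS: finite_measure ?SS by (intro finite_measure_pair_measure finite_measure_slab)
  interpret II: finite_measure "iv 1 \<Otimes>\<^sub>M iv 1" by (intro finite_measure_pair_measure finite_measure_iv)
  have \<omega>: "\<And>x. 0 \<le> \<omega> x" "\<And>x. \<omega> (x + 1) = \<omega> x" "continuous_on UNIV \<omega>'" "\<And>x. \<omega>' (x + 1) = \<omega>' x"
    using sk by (simp_all add: space_kernel_def)
  have \<theta>: "\<And>x. 0 \<le> \<theta> x" "continuous_on UNIV \<theta>'" "\<And>s. s \<le> 0 \<Longrightarrow> \<theta> s = 0" "\<And>s. e \<le> s \<Longrightarrow> \<theta> s = 0" "X 0 = 1"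
    using tk by (simp_all add: time_kernel_def)
  have cont: "continuous_on UNIV \<omega>" "continuous_on UNIV \<theta>" "continuous_on UNIV \<eta>"
    by (rule has_real_derivative_imp_continuous_on space_kernel_DERIV[OF sk] time_kernel_DERIV[OF tk] \<eta>(2))+
  note kb = space_kernel_bdd[OF sk] time_kernel_bdd[OF tk] time_kernel_bdd_antideriv[OF tk]
  have bS: "bdd_meas ?S U" "bdd_meas ?S V" "bdd_meas ?S A" "bdd_meas ?S B"
    by (intro bdd_meas_slab bdd)+
  have lift_space: "bdd_meas ?SS (\<lambda>z. f (fst (fst z) - fst (snd z)))" if "bdd_meas borel f" for f
    by (rule bdd_meas_comp[OF that]) measurable
  have lift_time: "bdd_meas ?SS (\<lambda>z. f (snd (snd z) - snd (fst z)))" "bdd_meas ?SS (\<lambda>z. f (snd (fst z)))"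
    "bdd_meas ?SS (\<lambda>z. f (snd (snd z)))" if "bdd_meas borel f" for f
    by (rule bdd_meas_comp[OF that], measurable)+
  have lift_st: "bdd_meas ?SS (\<lambda>z. f (fst z))" "bdd_meas ?SS (\<lambda>z. f (snd z))" if "bdd_meas ?S f" for f
    by (rule bdd_meas_comp[OF that], measurable)+
  note closure = bdd_meas_add bdd_meas_diff bdd_meas_mult bdd_meas_abs bdd_meas_sgn bdd_meas_flux bdd_meas_uminus

  \<comment> \<open>Here p = (x, t) and q = (y, s). \<open>E1\<close> is the integrand of the
    inequality for U in p with q frozen, \<open>E2\<close> that for V in q with p frozen; the factor
    \<eta> depends on t only, so it is differentiated in \<open>E1\<close> but is a constant in
    \<open>E2\<close>.\<close>
  define E1 where "E1 z = (case z of (p, q) \<Rightarrow>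
      \<bar>U p - V q\<bar> * (\<eta>' (snd p) * \<theta> (snd q - snd p) - \<eta> (snd p) * \<theta>' (snd q - snd p)) * \<omega> (fst p - fst q)
      + flux (U p) (V q) * (\<eta> (snd p) * \<theta> (snd q - snd p)) * \<omega>' (fst p - fst q)
      - sgn (U p - V q) * A p * (\<eta> (snd p) * \<theta> (snd q - snd p)) * \<omega> (fst p - fst q))" for z
  define E2 where "E2 z = (case z of (p, q) \<Rightarrow>
      \<bar>V q - U p\<bar> * (\<eta> (snd p) * \<theta>' (snd q - snd p)) * \<omega> (fst p - fst q)
      + flux (V q) (U p) * (\<eta> (snd p) * \<theta> (snd q - snd p)) * (- \<omega>' (fst p - fst q))
      - sgn (V q - U p) * B q * (\<eta> (snd p) * \<theta> (snd q - snd p)) * \<omega> (fst p - fst q))" for z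
  have bE: "bdd_meas ?SS E1" "bdd_meas ?SS E2"
    unfolding E1_def E2_def split_beta
    by (intro closure lift_st[OF bS(1)] lift_st[OF bS(2)] lift_st[OF bS(3)] lift_st[OF bS(4)]
        lift_space[OF kb(1)] lift_space[OF kb(2)]
        lift_time(1)[OF kb(3)] lift_time(1)[OF kb(4)] lift_time(2)[OF bdd(7)] lift_time(2)[OF bdd(8)])+

  define F1 where "F1 q = \<eta> 0 * \<theta> (snd q) * (\<integral>x. \<bar>U0 x - V q\<bar> * \<omega> (x - fst q) \<partial>iv 1)" for q
  have step1: "0 \<le> (\<integral>p. E1 (p, q) \<partial>?S) + F1 q" for q
  proof -
    have "product_test (\<lambda>x. \<omega> (x - fst q)) (\<lambda>x. \<omega>' (x - fst q)) (\<lambda>t. \<eta> t * \<theta> (snd q - t))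
        (\<lambda>t. \<eta>' t * \<theta> (snd q - t) - \<eta> t * \<theta>' (snd q - t))"
      unfolding product_test_def
    proof (intro conjI allI)
      show "\<omega> (x + 1 - fst q) = \<omega> (x - fst q)" for x
        using \<omega>(2)[of "x - fst q"] by (simp add: algebra_simps)
      show "((\<lambda>x. \<omega> (x - fst q)) has_real_derivative \<omega>' (x - fst q)) (at x)" for x
        by (rule DERIV_shift_left[OF space_kernel_DERIV(2)[OF sk]])
      show "continuous_on UNIV (\<lambda>x. \<omega>' (x - fst q))"
        by (intro continuous_on_compose2[OF \<omega>(3)] continuous_intros) auto
      show "((\<lambda>t. \<eta> t * \<theta> (snd q - t)) has_real_derivative \<eta>' t * \<theta> (snd q - t) - \<eta> t * \<theta>' (snd q - t)) (at t)" for t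
        using DERIV_mult[OF \<eta>(2) DERIV_shift_right[OF time_kernel_DERIV(2)[OF tk], of "snd q" t]]
        by (simp add: algebra_simps)
      show "continuous_on UNIV (\<lambda>t. \<eta>' t * \<theta> (snd q - t) - \<eta> t * \<theta>' (snd q - t))"
        by (intro continuous_intros continuous_on_compose2[OF cont(2)] continuous_on_compose2[OF \<theta>(2)] \<eta> cont) auto
      show "\<exists>R. \<forall>t. R < \<bar>t\<bar> \<longrightarrow> \<eta> t * \<theta> (snd q - t) = 0"
      proof (intro exI[of _ "\<bar>snd q\<bar> + e"] allI impI)
        fix t assume "\<bar>snd q\<bar> + e < \<bar>t\<bar>"
        then have "snd q - t \<le> 0 \<or> e \<le> snd q - t" by (auto simp: abs_if split: if_splits)
        then show "\<eta> t * \<theta> (snd q - t) = 0" using \<theta>(3,4) by auto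
      qed
    qed (use \<omega> \<theta> \<eta> in simp_all)
    from entropy_ineqD[OF ent_U this, of "V q"] show ?thesis
      by (simp add: E1_def F1_def)
  qed

  have step2: "0 \<le> (\<integral>q. E2 (p, q) \<partial>?S)" if "0 \<le> snd p" for p
  proof -
    have "product_test (\<lambda>y. \<omega> (fst p - y)) (\<lambda>y. - \<omega>' (fst p - y)) (\<lambda>s. \<eta> (snd p) * \<theta> (s - snd p))
        (\<lambda>s. \<eta> (snd p) * \<theta>' (s - snd p))"
      unfolding product_test_def
    proof (intro conjI allI)
      show "\<omega> (fst p - (y + 1)) = \<omega> (fst p - y)" for y
        using \<omega>(2)[of "fst p - (y + 1)"] by (simp add: algebra_simps)
      show "((\<lambda>y. \<omega> (fst p - y)) has_real_derivative - \<omega>' (fst p - y)) (at y)" for y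
        by (rule DERIV_shift_right[OF space_kernel_DERIV(2)[OF sk]])
      show "continuous_on UNIV (\<lambda>y. - \<omega>' (fst p - y))"
        by (intro continuous_intros continuous_on_compose2[OF \<omega>(3)]) auto
      show "((\<lambda>s. \<eta> (snd p) * \<theta> (s - snd p)) has_real_derivative \<eta> (snd p) * \<theta>' (s - snd p)) (at s)" for s
        by (rule DERIV_cmult[OF DERIV_shift_left[OF time_kernel_DERIV(2)[OF tk]]])
      show "continuous_on UNIV (\<lambda>s. \<eta> (snd p) * \<theta>' (s - snd p))"
        by (intro continuous_intros continuous_on_compose2[OF \<theta>(2)]) auto
      show "\<exists>R. \<forall>s. R < \<bar>s\<bar> \<longrightarrow> \<eta> (snd p) * \<theta> (s - snd p) = 0"
      proof (intro exI[of _ "\<bar>snd p\<bar> + e"] allI impI)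
        fix s assume "\<bar>snd p\<bar> + e < \<bar>s\<bar>"
        then have "s - snd p \<le> 0 \<or> e \<le> s - snd p" by (auto simp: abs_if split: if_splits)
        then show "\<eta> (snd p) * \<theta> (s - snd p) = 0" using \<theta>(3,4) by auto
      qed
    qed (use \<omega> \<theta> \<eta> in simp_all)
    from entropy_ineqD[OF ent_V this, of "U p"] show ?thesis
      using that \<theta>(3)[of "- snd p"] by (simp add: E2_def)
  qed

  \<comment> \<open>Up to the factor \<eta> 0, \<open>G\<close> is the integrand of the surviving
    initial term; \<open>G0\<close> is what it turns into when the values of V at small times give
    way to V0.\<close>
  define G where "G z = (case z of (x, q) \<Rightarrow> \<bar>U0 x - V q\<bar> * \<theta> (snd q) * \<omega> (x - fst q))" for z
  define G0 where "G0 z = \<bar>U0 (fst z) - V0 (snd z)\<bar> * \<omega> (fst z - snd z)" for z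
  have liftG: "bdd_meas (iv 1 \<Otimes>\<^sub>M ?S) (\<lambda>z. f (fst z))" "bdd_meas (iv 1 \<Otimes>\<^sub>M ?S) (\<lambda>z. f (fst z - fst (snd z)))"
    "bdd_meas (iv 1 \<Otimes>\<^sub>M ?S) (\<lambda>z. f (snd (snd z)))" if "bdd_meas borel f" for f
    by (rule bdd_meas_comp[OF that], measurable)+
  have liftGV: "bdd_meas (iv 1 \<Otimes>\<^sub>M ?S) (\<lambda>z. V (snd z))" "bdd_meas (iv 1 \<Otimes>\<^sub>M ?S) (\<lambda>z. B (snd z))"
    by (rule bdd_meas_comp[OF bS(2)] bdd_meas_comp[OF bS(4)], measurable)+
  have bG: "bdd_meas (iv 1 \<Otimes>\<^sub>M ?S) G"
    unfolding G_def split_beta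
    by (intro closure liftGV liftG(1)[OF bdd(1)] liftG(2)[OF kb(1)] liftG(3)[OF kb(3)])
  have bG0: "bdd_meas (iv 1 \<Otimes>\<^sub>M iv 1) G0"
    unfolding G0_def
    by (intro closure bdd_meas_comp[OF bdd(1)] bdd_meas_comp[OF bdd(2)] bdd_meas_comp[OF kb(1)]) measurable
  have "0 \<le> C" using C[of "(0, 0)" 0] by (simp add: abs_if split: if_splits)
  obtain P P' where P: "\<And>t. 0 \<le> P t" "\<And>t. (P has_real_derivative P' t) (at t)" "continuous_on UNIV P'"
    "\<And>t. t \<notin> {-1..0 + e} \<Longrightarrow> P t = 0" "\<And>t. t \<notin> {-1..0 + e} \<Longrightarrow> P' t = 0"
    "\<And>t. 0 \<le> t \<Longrightarrow> P t = X (t - 0)" "\<And>t. 0 \<le> t \<Longrightarrow> P' t = - \<theta> (t - 0)"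
    by (rule ex_cutoff[OF tk \<open>0 < e\<close> order_refl]) blast
  have bP: "bdd_meas borel P" "bdd_meas borel P'"
    using bdd_meas_compact_support[of P, OF has_real_derivative_imp_continuous_on[OF P(2)]]
      bdd_meas_compact_support[of P', OF P(3)] P(4,5) by blast+
  define E3 where "E3 z = (case z of (x, q) \<Rightarrow>
      \<bar>V q - U0 x\<bar> * P' (snd q) * \<omega> (x - fst q) + flux (V q) (U0 x) * P (snd q) * (- \<omega>' (x - fst q))
      - sgn (V q - U0 x) * B q * P (snd q) * \<omega> (x - fst q))" for z
  have bE3: "bdd_meas (iv 1 \<Otimes>\<^sub>M ?S) E3"
    unfolding E3_def split_beta
    by (intro closure liftGV liftG(1)[OF bdd(1)] liftG(2)[OF kb(1)] liftG(2)[OF kb(2)]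
        liftG(3)[OF bP(1)] liftG(3)[OF bP(2)])
  have bX: "bdd_meas ?S (\<lambda>q. X (snd q))"
    by (rule bdd_meas_comp[OF kb(5)]) measurable
  \<comment> \<open>For nonnegative times X is at most 1 and vanishes after e, so the flux and
    source terms of \<open>E3\<close>, which carry it as a factor, contribute at most
    \<open>C * e\<close>.\<close>
  have intX: "(\<integral>q. X (snd q) \<partial>?S) \<le> e"
  proof -
    have "(\<integral>q. X (snd q) \<partial>?S) = (\<integral>s. X s \<partial>iv T)"
      using slab_integral_product[OF bdd_meas_const[of _ 1] kb(5), of T] by simp
    also have "\<dots> \<le> (\<integral>s. indicator {..e} s \<partial>iv T)"
    proof (rule integral_mono)
      show "X s \<le> indicator {..e} s" for s
        using time_kernel_le_1[OF tk, of s] tk by (auto simp: indicator_def time_kernel_def)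
    qed (auto intro!: IT.bdd_meas_integrable bdd_meas_iv kb)
    also have "\<dots> \<le> e"
      using measure_iv_le[of "{..e}" T 0 e] \<open>0 < e\<close> by simp
    finally show ?thesis .
  qed
  have sgn_le: "- (sgn a * b) \<le> \<bar>b\<bar>" for a b :: real
    by (auto simp: sgn_if)
  \<comment> \<open>For nonnegative times the derivative of P is - \<theta>, so the time term of the
    inequality is exactly - \<open>G\<close>; its initial term is the integral of \<open>G0\<close>
    because P 0 = X 0 = 1.\<close>
  have step3: "(\<integral>q. G (x, q) \<partial>?S) \<le> C * e + (\<integral>y. G0 (x, y) \<partial>iv 1)" for x
  proof -
    have "product_test (\<lambda>y. \<omega> (x - y)) (\<lambda>y. - \<omega>' (x - y)) P P'"
      unfolding product_test_def
    proof (intro conjI allI)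
      show "\<omega> (x - (y + 1)) = \<omega> (x - y)" for y
        using \<omega>(2)[of "x - (y + 1)"] by (simp add: algebra_simps)
      show "((\<lambda>y. \<omega> (x - y)) has_real_derivative - \<omega>' (x - y)) (at y)" for y
        by (rule DERIV_shift_right[OF space_kernel_DERIV(2)[OF sk]])
      show "continuous_on UNIV (\<lambda>y. - \<omega>' (x - y))"
        by (intro continuous_intros continuous_on_compose2[OF \<omega>(3)]) auto
      show "\<exists>R. \<forall>t. R < \<bar>t\<bar> \<longrightarrow> P t = 0"
        by (rule exI[of _ "max e 1"]) (use \<open>0 < e\<close> in \<open>auto intro!: P(4)\<close>)
    qed (use \<omega> P(1-3) in simp_all)
    from entropy_ineqD[OF ent_V this, of "U0 x"]
    have "0 \<le> (\<integral>q. E3 (x, q) \<partial>?S) + (\<integral>y. G0 (x, y) \<partial>iv 1)"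
      using P(6)[of 0] \<theta>(5) by (simp add: E3_def G0_def abs_minus_commute)
    also have "(\<integral>q. E3 (x, q) \<partial>?S) \<le> (\<integral>q. C * X (snd q) - G (x, q) \<partial>?S)"
    proof (rule integral_mono_AE)
      show "AE q in ?S. E3 (x, q) \<le> C * X (snd q) - G (x, q)"
        using AE_slab
      proof eventually_elim
        case (elim q)
        have X: "0 \<le> X (snd q)" by (rule time_kernel_nonneg[OF tk])
        have "E3 (x, q) = X (snd q) * (- (flux (V q) (U0 x) * \<omega>' (x - fst q)) - sgn (V q - U0 x) * (B q * \<omega> (x - fst q)))
            - G (x, q)"
          using elim P(6,7) by (simp add: E3_def G_def abs_minus_commute algebra_simps)
        also have "\<dots> \<le> X (snd q) * C - G (x, q)"
          using C[of q x] sgn_le[of "V q - U0 x" "B q * \<omega> (x - fst q)"] X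
          by (intro diff_right_mono mult_left_mono) linarith+
        finally show ?case by (simp add: mult.commute)
      qed
    qed (intro S.bdd_meas_integrable bdd_meas_diff bdd_meas_mult bdd_meas_const bX
        bdd_meas_section[OF bE3] bdd_meas_section[OF bG]; simp)+
    also have "\<dots> = C * (\<integral>q. X (snd q) \<partial>?S) - (\<integral>q. G (x, q) \<partial>?S)"
      using S.bdd_meas_integrable[OF bX] S.bdd_meas_integrable[OF bdd_meas_section[OF bG, of x]] by simp
    also have "C * (\<integral>q. X (snd q) \<partial>?S) \<le> C * e" using intX \<open>0 \<le> C\<close> by (rule mult_left_mono)
    finally show ?thesis by simp
  qed
  have F1_eq: "F1 q = \<eta> 0 * (\<integral>x. G (x, q) \<partial>iv 1)" for q
  proof -
    have "(\<integral>x. G (x, q) \<partial>iv 1) = (\<integral>x. \<theta> (snd q) * (\<bar>U0 x - V q\<bar> * \<omega> (x - fst q)) \<partial>iv 1)"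
      by (simp add: G_def mult_ac)
    then show ?thesis by (simp add: F1_def)
  qed
  have bG': "bdd_meas ?S (\<lambda>q. \<integral>x. G (x, q) \<partial>iv 1)"
  proof -
    have "bdd_meas (?S \<Otimes>\<^sub>M iv 1) (\<lambda>z. G (snd z, fst z))"
      by (rule bdd_meas_comp[OF bG]) measurable
    from I.bdd_meas_integral[OF this] show ?thesis by simp
  qed
  have "(\<integral>q. F1 q \<partial>?S) = \<eta> 0 * (\<integral>z. G z \<partial>(iv 1 \<Otimes>\<^sub>M ?S))"
    unfolding F1_eq using integral_pair_snd[OF finite_measure_iv finite_measure_slab bG] by simp
  also have "(\<integral>z. G z \<partial>(iv 1 \<Otimes>\<^sub>M ?S)) = (\<integral>x. \<integral>q. G (x, q) \<partial>?S \<partial>iv 1)"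
    using integral_pair_fst[OF finite_measure_iv finite_measure_slab bG] by simp
  also have "\<dots> \<le> (\<integral>x. C * e + (\<integral>y. G0 (x, y) \<partial>iv 1) \<partial>iv 1)"
    by (intro integral_mono step3 I.bdd_meas_integrable bdd_meas_add bdd_meas_const
        S.bdd_meas_integral[OF bG] I.bdd_meas_integral[OF bG0])
  also have "\<dots> = C * e + (\<integral>z. G0 z \<partial>(iv 1 \<Otimes>\<^sub>M iv 1))"
    using integral_pair_fst[OF finite_measure_iv finite_measure_iv bG0]
      I.bdd_meas_integrable[OF I.bdd_meas_integral[OF bG0]] measure_iv[of 1] by simp
  finally have F1: "(\<integral>q. F1 q \<partial>?S) \<le> \<eta> 0 * (C * e + (\<integral>z. G0 z \<partial>(iv 1 \<Otimes>\<^sub>M iv 1)))"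
    using \<eta>(1)[of 0] by (simp add: mult_left_mono)

  have "0 \<le> (\<integral>q. (\<integral>p. E1 (p, q) \<partial>?S) + F1 q \<partial>?S)"
    using step1 by (intro Bochner_Integration.integral_nonneg)
  also have "\<dots> = (\<integral>q. \<integral>p. E1 (p, q) \<partial>?S \<partial>?S) + (\<integral>q. F1 q \<partial>?S)"
  proof (rule Bochner_Integration.integral_add)
    have "bdd_meas ?SS (\<lambda>z. E1 (snd z, fst z))"
      by (rule bdd_meas_comp[OF bE(1)]) measurable
    from S.bdd_meas_integrable[OF S.bdd_meas_integral[OF this]]
    show "integrable ?S (\<lambda>q. \<integral>p. E1 (p, q) \<partial>?S)" by simp
    show "integrable ?S F1"
      unfolding F1_eq[abs_def] by (intro S.bdd_meas_integrable bdd_meas_mult bdd_meas_const bG')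
  qed
  also have "(\<integral>q. \<integral>p. E1 (p, q) \<partial>?S \<partial>?S) = (\<integral>z. E1 z \<partial>?SS)"
    by (rule integral_pair_snd[OF finite_measure_slab finite_measure_slab bE(1)])
  finally have i1: "0 \<le> (\<integral>z. E1 z \<partial>?SS) + (\<integral>q. F1 q \<partial>?S)" .
  have "0 \<le> (\<integral>p. \<integral>q. E2 (p, q) \<partial>?S \<partial>?S)"
  proof (rule integral_nonneg_AE)
    show "AE p in ?S. 0 \<le> (\<integral>q. E2 (p, q) \<partial>?S)"
      using AE_slab by eventually_elim (auto intro!: step2)
  qed
  also have "\<dots> = (\<integral>z. E2 z \<partial>?SS)"
    by (rule integral_pair_fst[OF finite_measure_slab finite_measure_slab bE(2)])
  finally have i2: "0 \<le> (\<integral>z. E2 z \<partial>?SS)" .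
  have bR: "bdd_meas ?SS (\<lambda>z. \<bar>U (fst z) - V (snd z)\<bar> * \<eta>' (snd (fst z)) * st_kernel \<omega> \<theta> z)"
    "bdd_meas ?SS (\<lambda>z. \<bar>A (fst z) - B (snd z)\<bar> * \<eta> (snd (fst z)) * st_kernel \<omega> \<theta> z)"
    by (intro closure lift_st[OF bS(1)] lift_st[OF bS(2)] lift_st[OF bS(3)] lift_st[OF bS(4)]
        st_kernel_bdd[OF T sk tk] lift_time(2)[OF bdd(7)] lift_time(2)[OF bdd(8)])+
  have "(\<integral>z. E1 z \<partial>?SS) + (\<integral>z. E2 z \<partial>?SS) = (\<integral>z. E1 z + E2 z \<partial>?SS)"
    using SS.bdd_meas_integrable[OF bE(1)] SS.bdd_meas_integrable[OF bE(2)] by simp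
  also have "\<dots> \<le> (\<integral>z. \<bar>U (fst z) - V (snd z)\<bar> * \<eta>' (snd (fst z)) * st_kernel \<omega> \<theta> z
       + \<bar>A (fst z) - B (snd z)\<bar> * \<eta> (snd (fst z)) * st_kernel \<omega> \<theta> z \<partial>?SS)"
  proof (rule integral_mono)
    fix z :: "(real \<times> real) \<times> (real \<times> real)"
    obtain p q where z: "z = (p, q)" by (metis surj_pair)
    \<comment> \<open>The \<theta>' terms cancel because \<theta> (s - t) has opposite derivatives
      in t and s. The sign function is odd, which merges the two sources into their
      difference.\<close>
    have E: "E1 z + E2 z = \<bar>U p - V q\<bar> * \<eta>' (snd p) * st_kernel \<omega> \<theta> z
        - sgn (U p - V q) * (A p - B q) * (\<eta> (snd p) * st_kernel \<omega> \<theta> z)"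
    proof -
      have s: "sgn (V q - U p) = - sgn (U p - V q)" by (simp add: sgn_if)
      show ?thesis
        unfolding z E1_def E2_def st_kernel_def prod.case fst_conv snd_conv flux_commute[of "V q"]
          abs_minus_commute[of "V q"] s
        by (simp add: algebra_simps)
    qed
    have "- sgn (U p - V q) * (A p - B q) \<le> \<bar>A p - B q\<bar>"
      using sgn_le[of "U p - V q" "A p - B q"] by simp
    then have "- sgn (U p - V q) * (A p - B q) * (\<eta> (snd p) * st_kernel \<omega> \<theta> z)
        \<le> \<bar>A p - B q\<bar> * (\<eta> (snd p) * st_kernel \<omega> \<theta> z)"
      using \<eta>(1) st_kernel_nonneg[OF T sk tk] by (intro mult_right_mono) auto
    then show "E1 z + E2 z \<le> \<bar>U (fst z) - V (snd z)\<bar> * \<eta>' (snd (fst z)) * st_kernel \<omega> \<theta> z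
       + \<bar>A (fst z) - B (snd z)\<bar> * \<eta> (snd (fst z)) * st_kernel \<omega> \<theta> z"
      unfolding E by (simp add: z mult.assoc)
  qed (intro SS.bdd_meas_integrable bdd_meas_add bE bR)+
  also have "\<dots> = (\<integral>z. \<bar>U (fst z) - V (snd z)\<bar> * \<eta>' (snd (fst z)) * st_kernel \<omega> \<theta> z \<partial>?SS)
      + (\<integral>z. \<bar>A (fst z) - B (snd z)\<bar> * \<eta> (snd (fst z)) * st_kernel \<omega> \<theta> z \<partial>?SS)"
    using SS.bdd_meas_integrable[OF bR(1)] SS.bdd_meas_integrable[OF bR(2)] by simp
  finally show ?thesis
    using i1 i2 F1 unfolding G0_def by (simp add: add.commute)
qed

end

text \<open>The second point is moved back to the first. U, A and U0 already sit at the first point,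
  so mollification estimates are needed only for V, B and V0. Requiring \<eta>' to vanish from some
  b < T on keeps the kernel's loss of mass near T away from the term with \<eta>'.\<close>

lemma kruzkov_comparison:
  fixes T b :: real
  assumes T: "0 < T"
    and bdd: "bdd_meas borel U0" "bdd_meas borel V0" "bdd_meas borel U" "bdd_meas borel V"
      "bdd_meas borel A" "bdd_meas borel B" "bdd_meas borel \<eta>" "bdd_meas borel \<eta>'"
    and ent: "entropy_ineq T U0 U A" "entropy_ineq T V0 V B"
    and \<eta>: "\<And>t. 0 \<le> \<eta> t" "\<And>t. (\<eta> has_real_derivative \<eta>' t) (at t)" "continuous_on UNIV \<eta>'"
    and b: "b < T" "\<And>t. b \<le> t \<Longrightarrow> \<eta>' t = 0"
  shows "0 \<le> (\<integral>p. \<bar>U p - V p\<bar> * \<eta>' (snd p) \<partial>slab T) + (\<integral>p. \<bar>A p - B p\<bar> * \<eta> (snd p) \<partial>slab T)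
      + \<eta> 0 * (\<integral>x. \<bar>U0 x - V0 x\<bar> \<partial>iv 1)"
proof (rule field_le_epsilon)
  fix \<kappa> :: real assume "0 < \<kappa>"
  let ?S = "slab T" and ?SS = "slab T \<Otimes>\<^sub>M slab T" and ?I = "iv 1" and ?II = "iv 1 \<Otimes>\<^sub>M iv 1"
  interpret S: finite_measure ?S by simp
  interpret SS: finite_measure ?SS by (intro finite_measure_pair_measure finite_measure_slab)
  interpret I: finite_measure ?I by simp
  interpret II: finite_measure ?II by (intro finite_measure_pair_measure finite_measure_iv)
  obtain N1 where N1: "0 \<le> N1" "\<And>t. \<bar>\<eta> t\<bar> \<le> N1" using bdd(7) by (elim bdd_measE) simp
  obtain N2 where N2: "0 \<le> N2" "\<And>t. \<bar>\<eta>' t\<bar> \<le> N2" using bdd(8) by (elim bdd_measE) simp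
  define N where "N = max N1 N2"
  have N: "0 \<le> N" "\<And>t. \<bar>\<eta> t\<bar> \<le> N" "\<And>t. \<bar>\<eta>' t\<bar> \<le> N"
    using N1 N2 by (auto simp: N_def le_max_iff_disj)
  \<comment> \<open>The error is at most \<open>4 * N * \<epsilon>\<close>: one share each from
    \<open>term1\<close> and \<open>term2\<close>, and two from the initial term, namely the
    mollification of V0 and the cost \<open>C * e\<close>.\<close>
  define \<epsilon> where "\<epsilon> = \<kappa> / (4 * (N + 1))"
  have \<epsilon>: "0 < \<epsilon>" "4 * (N * \<epsilon>) \<le> \<kappa>"
    using \<open>0 < \<kappa>\<close> N(1) by (auto simp: \<epsilon>_def field_simps)
  obtain dV where dV: "0 < dV" "\<And>d W \<omega> \<omega>' e X \<theta> \<theta>'. 0 < d \<Longrightarrow> d < dV \<Longrightarrow> e < dV \<Longrightarrow> space_kernel d W \<omega> \<omega>' \<Longrightarrow> time_kernel e X \<theta> \<theta>' \<Longrightarrow>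
      (\<integral>z. \<bar>V (fst z) - V (snd z)\<bar> * st_kernel \<omega> \<theta> z \<partial>?SS) \<le> \<epsilon>"
    by (rule mollification_error_space_time[OF bdd(4) T \<epsilon>(1)]) blast
  obtain dB where dB: "0 < dB" "\<And>d W \<omega> \<omega>' e X \<theta> \<theta>'. 0 < d \<Longrightarrow> d < dB \<Longrightarrow> e < dB \<Longrightarrow> space_kernel d W \<omega> \<omega>' \<Longrightarrow> time_kernel e X \<theta> \<theta>' \<Longrightarrow>
      (\<integral>z. \<bar>B (fst z) - B (snd z)\<bar> * st_kernel \<omega> \<theta> z \<partial>?SS) \<le> \<epsilon>"
    by (rule mollification_error_space_time[OF bdd(6) T \<epsilon>(1)]) blast
  obtain d0 where d0: "0 < d0" "\<And>d W \<omega> \<omega>'. 0 < d \<Longrightarrow> d < d0 \<Longrightarrow> space_kernel d W \<omega> \<omega>' \<Longrightarrow>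
      (\<integral>z. \<bar>V0 (fst z) - V0 (snd z)\<bar> * \<omega> (fst z - snd z) \<partial>?II) \<le> \<epsilon>"
    by (rule mollification_error_space[OF bdd(2) \<epsilon>(1)]) blast
  define d where "d = Min {dV, dB, d0, 1/2} / 2"
  have d: "0 < d" "d < dV" "d < dB" "d < d0" "d < 1/2"
    using dV(1) dB(1) d0(1) by (auto simp: d_def)
  obtain W \<omega> \<omega>' where sk: "space_kernel d W \<omega> \<omega>'" using ex_space_kernel[OF d(1,5)] by blast
  \<comment> \<open>C bounds a term with \<omega>' and thus depends on the kernel already chosen; e
    can only be fixed afterwards.\<close>
  obtain C where C: "0 \<le> C" "\<And>x q. \<bar>flux (V q) (U0 x) * \<omega>' (x - fst q)\<bar> + \<bar>B q * \<omega> (x - fst q)\<bar> \<le> C"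
  proof -
    have "bdd_meas (borel \<Otimes>\<^sub>M borel) (\<lambda>z. \<bar>flux (V (snd z)) (U0 (fst z)) * \<omega>' (fst z - fst (snd z))\<bar>
        + \<bar>B (snd z) * \<omega> (fst z - fst (snd z))\<bar>)"
      by (intro bdd_meas_add bdd_meas_mult bdd_meas_abs bdd_meas_flux bdd_meas_comp[OF bdd(4)]
          bdd_meas_comp[OF bdd(1)] bdd_meas_comp[OF bdd(6)] bdd_meas_comp[OF space_kernel_bdd(1)[OF sk]]
          bdd_meas_comp[OF space_kernel_bdd(2)[OF sk]]) (simp_all flip: borel_prod)
    then obtain C where "0 \<le> C" and C: "\<And>z. \<bar>\<bar>flux (V (snd z)) (U0 (fst z)) * \<omega>' (fst z - fst (snd z))\<bar>
        + \<bar>B (snd z) * \<omega> (fst z - fst (snd z))\<bar>\<bar> \<le> C"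
      by (elim bdd_measE) (simp add: space_pair_measure)
    show ?thesis
      by (rule that[OF \<open>0 \<le> C\<close>]) (use C[of "(_, _)"] in force)
  qed
  \<comment> \<open>Staying below T - b gives the kernel full mass wherever \<eta>' is nonzero;
    staying below the last entry keeps the cost \<open>C * e\<close> within \<epsilon>.\<close>
  define e where "e = Min {dV, dB, T - b, \<epsilon> / (C + 1)} / 2"
  have e: "0 < e" "e < dV" "e < dB" "e < T - b" "e < \<epsilon> / (C + 1)"
  proof -
    define m where "m = Min {dV, dB, T - b, \<epsilon> / (C + 1)}"
    have "0 < m" "m \<le> dV" "m \<le> dB" "m \<le> T - b" "m \<le> \<epsilon> / (C + 1)"
      using dV(1) dB(1) b(1) \<epsilon>(1) C(1) by (auto simp: m_def)
    moreover have "e = m / 2" by (simp add: e_def m_def)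
    ultimately show "0 < e" "e < dV" "e < dB" "e < T - b" "e < \<epsilon> / (C + 1)" by linarith+
  qed
  have Ce: "C * e \<le> \<epsilon>"
  proof -
    have "(C + 1) * e \<le> \<epsilon>" using e(5) C(1) by (simp add: field_simps)
    then show ?thesis using e(1) by (simp add: algebra_simps)
  qed
  obtain X \<theta> \<theta>' where tk: "time_kernel e X \<theta> \<theta>'" using ex_time_kernel[OF e(1)] by blast
  let ?J = "st_kernel \<omega> \<theta>"
  note J = st_kernel_bdd[OF T sk tk] st_kernel_nonneg[OF T sk tk]
  have bS: "bdd_meas ?S U" "bdd_meas ?S V" "bdd_meas ?S A" "bdd_meas ?S B"
    by (intro bdd_meas_slab bdd)+
  have lift_time: "bdd_meas ?SS (\<lambda>z. f (snd (fst z)))" "bdd_meas ?S (\<lambda>p. f (snd p))" if "bdd_meas borel f" for f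
    by (rule bdd_meas_comp[OF that], measurable)+
  have lift_st: "bdd_meas ?SS (\<lambda>z. f (fst z))" "bdd_meas ?SS (\<lambda>z. f (snd z))" if "bdd_meas ?S f" for f
    by (rule bdd_meas_comp[OF that], measurable)+
  note closure = bdd_meas_add bdd_meas_diff bdd_meas_mult bdd_meas_abs
  note lifts = lift_st[OF bS(1)] lift_st[OF bS(2)] lift_st[OF bS(3)] lift_st[OF bS(4)] J(1)
    lift_time[OF bdd(7)] lift_time[OF bdd(8)] bS
  have term1: "(\<integral>z. \<bar>U (fst z) - V (snd z)\<bar> * \<eta>' (snd (fst z)) * ?J z \<partial>?SS)
      \<le> (\<integral>p. \<bar>U p - V p\<bar> * \<eta>' (snd p) \<partial>?S) + N * \<epsilon>"
  proof -
    have b1: "bdd_meas ?SS (\<lambda>z. \<bar>U (fst z) - V (fst z)\<bar> * \<eta>' (snd (fst z)) * ?J z)"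
      and b2: "bdd_meas ?SS (\<lambda>z. \<bar>V (fst z) - V (snd z)\<bar> * ?J z)"
      by (intro closure lifts)+
    have "(\<integral>z. \<bar>U (fst z) - V (snd z)\<bar> * \<eta>' (snd (fst z)) * ?J z \<partial>?SS)
      \<le> (\<integral>z. \<bar>U (fst z) - V (fst z)\<bar> * \<eta>' (snd (fst z)) * ?J z + N * (\<bar>V (fst z) - V (snd z)\<bar> * ?J z) \<partial>?SS)"
    proof (rule integral_mono)
      fix z :: "(real \<times> real) \<times> (real \<times> real)"
      let ?u = "U (fst z)" and ?v = "V (fst z)" and ?w = "V (snd z)" and ?h = "\<eta>' (snd (fst z))"
      have "(\<bar>?u - ?w\<bar> - \<bar>?u - ?v\<bar>) * ?h \<le> \<bar>\<bar>?u - ?w\<bar> - \<bar>?u - ?v\<bar>\<bar> * \<bar>?h\<bar>"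
        by (metis abs_ge_self abs_mult)
      also have "\<dots> \<le> \<bar>?v - ?w\<bar> * N"
        by (intro mult_mono N) auto
      finally have "(\<bar>?u - ?w\<bar> * ?h) * ?J z \<le> (\<bar>?u - ?v\<bar> * ?h + N * \<bar>?v - ?w\<bar>) * ?J z"
        by (intro mult_right_mono J(2)) (simp add: algebra_simps)
      then show "\<bar>?u - ?w\<bar> * ?h * ?J z \<le> \<bar>?u - ?v\<bar> * ?h * ?J z + N * (\<bar>?v - ?w\<bar> * ?J z)"
        by (simp add: algebra_simps)
    qed (intro SS.bdd_meas_integrable closure lifts bdd_meas_const)+
    also have "\<dots> = (\<integral>z. \<bar>U (fst z) - V (fst z)\<bar> * \<eta>' (snd (fst z)) * ?J z \<partial>?SS)
        + N * (\<integral>z. \<bar>V (fst z) - V (snd z)\<bar> * ?J z \<partial>?SS)"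
      using SS.bdd_meas_integrable[OF b1] SS.bdd_meas_integrable[OF b2] by simp
    also have "(\<integral>z. \<bar>U (fst z) - V (fst z)\<bar> * \<eta>' (snd (fst z)) * ?J z \<partial>?SS)
        = (\<integral>p. \<bar>U p - V p\<bar> * \<eta>' (snd p) * (\<integral>q. ?J (p, q) \<partial>?S) \<partial>?S)"
      using integral_pair_fst[OF finite_measure_slab finite_measure_slab b1] by simp
    \<comment> \<open>Since \<eta>' may be negative, an upper bound on the marginal would not do: it
      is exactly 1 wherever \<eta>' is nonzero. In \<open>term2\<close> the weight \<eta> is
      nonnegative and the upper bound is enough.\<close>
    also have "\<dots> = (\<integral>p. \<bar>U p - V p\<bar> * \<eta>' (snd p) \<partial>?S)"
    proof (rule integral_cong_AE)
      show "AE p in ?S. \<bar>U p - V p\<bar> * \<eta>' (snd p) * (\<integral>q. ?J (p, q) \<partial>?S) = \<bar>U p - V p\<bar> * \<eta>' (snd p)"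
        using AE_slab
      proof eventually_elim
        case (elim p)
        show ?case
        proof (cases "snd p \<le> T - e")
          case True
          then show ?thesis using elim st_kernel_marginal_eq[OF T sk tk, of p] by simp
        next
          case False
          then show ?thesis using b(2)[of "snd p"] e(4) by simp
        qed
      qed
      show "(\<lambda>p. \<bar>U p - V p\<bar> * \<eta>' (snd p) * (\<integral>q. ?J (p, q) \<partial>?S)) \<in> borel_measurable ?S"
        by (rule bdd_measD) (intro closure lifts S.bdd_meas_integral)
      show "(\<lambda>p. \<bar>U p - V p\<bar> * \<eta>' (snd p)) \<in> borel_measurable ?S"
        by (rule bdd_measD) (intro closure lifts)
    qed
    finally show ?thesis
      using mult_left_mono[OF dV(2)[OF d(1,2) e(2) sk tk] N(1)] by simp
  qed
  have term2: "(\<integral>z. \<bar>A (fst z) - B (snd z)\<bar> * \<eta> (snd (fst z)) * ?J z \<partial>?SS)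
      \<le> (\<integral>p. \<bar>A p - B p\<bar> * \<eta> (snd p) \<partial>?S) + N * \<epsilon>"
  proof -
    have b1: "bdd_meas ?SS (\<lambda>z. \<bar>A (fst z) - B (fst z)\<bar> * \<eta> (snd (fst z)) * ?J z)"
      and b2: "bdd_meas ?SS (\<lambda>z. \<bar>B (fst z) - B (snd z)\<bar> * ?J z)"
      and b3: "bdd_meas ?S (\<lambda>p. \<bar>A p - B p\<bar> * \<eta> (snd p))"
      by (intro closure lifts)+
    have "(\<integral>z. \<bar>A (fst z) - B (snd z)\<bar> * \<eta> (snd (fst z)) * ?J z \<partial>?SS)
      \<le> (\<integral>z. \<bar>A (fst z) - B (fst z)\<bar> * \<eta> (snd (fst z)) * ?J z + N * (\<bar>B (fst z) - B (snd z)\<bar> * ?J z) \<partial>?SS)"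
    proof (rule integral_mono)
      fix z :: "(real \<times> real) \<times> (real \<times> real)"
      let ?u = "A (fst z)" and ?v = "B (fst z)" and ?w = "B (snd z)" and ?h = "\<eta> (snd (fst z))"
      have "(\<bar>?u - ?w\<bar> - \<bar>?u - ?v\<bar>) * ?h \<le> \<bar>\<bar>?u - ?w\<bar> - \<bar>?u - ?v\<bar>\<bar> * \<bar>?h\<bar>"
        by (metis abs_ge_self abs_mult)
      also have "\<dots> \<le> \<bar>?v - ?w\<bar> * N"
        by (intro mult_mono N) auto
      finally have "(\<bar>?u - ?w\<bar> * ?h) * ?J z \<le> (\<bar>?u - ?v\<bar> * ?h + N * \<bar>?v - ?w\<bar>) * ?J z"
        by (intro mult_right_mono J(2)) (simp add: algebra_simps)
      then show "\<bar>?u - ?w\<bar> * ?h * ?J z \<le> \<bar>?u - ?v\<bar> * ?h * ?J z + N * (\<bar>?v - ?w\<bar> * ?J z)"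
        by (simp add: algebra_simps)
    qed (intro SS.bdd_meas_integrable closure lifts bdd_meas_const)+
    also have "\<dots> = (\<integral>z. \<bar>A (fst z) - B (fst z)\<bar> * \<eta> (snd (fst z)) * ?J z \<partial>?SS)
        + N * (\<integral>z. \<bar>B (fst z) - B (snd z)\<bar> * ?J z \<partial>?SS)"
      using SS.bdd_meas_integrable[OF b1] SS.bdd_meas_integrable[OF b2] by simp
    also have "(\<integral>z. \<bar>A (fst z) - B (fst z)\<bar> * \<eta> (snd (fst z)) * ?J z \<partial>?SS) \<le> (\<integral>p. \<bar>A p - B p\<bar> * \<eta> (snd p) \<partial>?S)"
      using integral_fst_kernel_le[OF finite_measure_slab J _ b3] st_kernel_marginals(1)[OF T sk tk] \<eta>(1)
      by simp
    finally show ?thesis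
      using mult_left_mono[OF dB(2)[OF d(1,3) e(3) sk tk] N(1)] by simp
  qed
  have term3: "(\<integral>z. \<bar>U0 (fst z) - V0 (snd z)\<bar> * \<omega> (fst z - snd z) \<partial>?II) \<le> (\<integral>x. \<bar>U0 x - V0 x\<bar> \<partial>?I) + \<epsilon>"
  proof -
    have bI: "bdd_meas ?I (\<lambda>x. \<bar>U0 x - V0 x\<bar>)"
      by (intro closure bdd_meas_iv bdd)
    have bJ: "bdd_meas ?II (\<lambda>z. \<omega> (fst z - snd z))"
      by (rule bdd_meas_comp[OF space_kernel_bdd(1)[OF sk]]) measurable
    have lI: "bdd_meas ?II (\<lambda>z. f (fst z))" "bdd_meas ?II (\<lambda>z. f (snd z))" if "bdd_meas borel f" for f
      by (rule bdd_meas_comp[OF that], measurable)+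
    have b1: "bdd_meas ?II (\<lambda>z. \<bar>U0 (fst z) - V0 (fst z)\<bar> * \<omega> (fst z - snd z))"
      and b2: "bdd_meas ?II (\<lambda>z. \<bar>V0 (fst z) - V0 (snd z)\<bar> * \<omega> (fst z - snd z))"
      by (intro closure lI[OF bdd(1)] lI[OF bdd(2)] bJ)+
    have "(\<integral>z. \<bar>U0 (fst z) - V0 (snd z)\<bar> * \<omega> (fst z - snd z) \<partial>?II)
      \<le> (\<integral>z. \<bar>U0 (fst z) - V0 (fst z)\<bar> * \<omega> (fst z - snd z) + \<bar>V0 (fst z) - V0 (snd z)\<bar> * \<omega> (fst z - snd z) \<partial>?II)"
    proof (rule integral_mono)
      show "\<bar>U0 (fst z) - V0 (snd z)\<bar> * \<omega> (fst z - snd z)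
        \<le> \<bar>U0 (fst z) - V0 (fst z)\<bar> * \<omega> (fst z - snd z) + \<bar>V0 (fst z) - V0 (snd z)\<bar> * \<omega> (fst z - snd z)" for z
        unfolding distrib_right[symmetric]
        by (rule mult_right_mono[OF _ space_kernel_pos[OF sk]]) arith
    qed (intro II.bdd_meas_integrable closure lI[OF bdd(1)] lI[OF bdd(2)] bJ)+
    also have "\<dots> = (\<integral>z. \<bar>U0 (fst z) - V0 (fst z)\<bar> * \<omega> (fst z - snd z) \<partial>?II)
        + (\<integral>z. \<bar>V0 (fst z) - V0 (snd z)\<bar> * \<omega> (fst z - snd z) \<partial>?II)"
      using II.bdd_meas_integrable[OF b1] II.bdd_meas_integrable[OF b2] by simp
    also have "(\<integral>z. \<bar>U0 (fst z) - V0 (fst z)\<bar> * \<omega> (fst z - snd z) \<partial>?II) \<le> (\<integral>x. \<bar>U0 x - V0 x\<bar> \<partial>?I)"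
      using integral_fst_kernel_le[OF finite_measure_iv bJ space_kernel_pos[OF sk] _ bI]
        integral_space_kernel_snd[OF sk] by simp
    finally show ?thesis using d0(2)[OF d(1,4) sk] by simp
  qed
  have "\<eta> 0 * ((\<integral>z. \<bar>U0 (fst z) - V0 (snd z)\<bar> * \<omega> (fst z - snd z) \<partial>?II) + C * e)
      \<le> \<eta> 0 * ((\<integral>x. \<bar>U0 x - V0 x\<bar> \<partial>?I) + 2 * \<epsilon>)"
    using term3 Ce \<eta>(1) by (intro mult_left_mono) auto
  moreover have "\<eta> 0 * (2 * \<epsilon>) \<le> N * (2 * \<epsilon>)"
    using N(2)[of 0] \<epsilon>(1) by (intro mult_right_mono) auto
  ultimately show "0 \<le> (\<integral>p. \<bar>U p - V p\<bar> * \<eta>' (snd p) \<partial>?S) + (\<integral>p. \<bar>A p - B p\<bar> * \<eta> (snd p) \<partial>?S)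
      + \<eta> 0 * (\<integral>x. \<bar>U0 x - V0 x\<bar> \<partial>?I) + \<kappa>"
    using doubling_inequality[OF T bdd ent \<eta> sk tk e(1) C(2)] term1 term2 \<epsilon>(2)
    by (simp add: distrib_left)
qed

subsection \<open>The Fornberg--Whitham kernel\<close>

lemma FW_Kd_measurable [measurable]: "FW_Kd \<in> borel_measurable borel"
proof -
  have "(\<lambda>x. sinh (frac x - 1 / 2) :: real) \<in> borel_measurable borel"
    unfolding frac_def sinh_def by measurable
  then show ?thesis unfolding FW_Kd_def by measurable
qed

definition FW_c :: real where "FW_c = sqrt (exp 1) / (exp 1 - 1)"

lemma FW_c_pos: "0 < FW_c"
proof -
  have "1 < exp (1::real)" by simp
  then show ?thesis by (simp add: FW_c_def)
qed

lemma abs_FW_Kd_le_sup: "\<bar>FW_Kd x\<bar> \<le> FW_c * sinh (1/2)"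
proof -
  have "- (1/2) \<le> frac x - 1/2" "frac x - 1/2 \<le> 1/2" using frac_lt_1[of x] by auto
  then have "sinh (- (1/2)) \<le> sinh (frac x - 1/2)" "sinh (frac x - 1/2) \<le> (sinh (1/2) :: real)"
    by (simp_all only: sinh_real_le_iff)
  then have "\<bar>sinh (frac x - 1/2)\<bar> \<le> (sinh (1/2) :: real)"
    unfolding sinh_minus by (intro abs_leI) linarith+
  then show ?thesis
    using FW_c_pos by (simp add: FW_Kd_def abs_mult mult_left_mono flip: FW_c_def)
qed

lemma bdd_meas_FW_Kd: "bdd_meas borel FW_Kd"
  by (rule bdd_measI[OF FW_Kd_measurable abs_FW_Kd_le_sup])

text \<open>The norm is an essential supremum, but the bound is wanted at every point. On the open
  unit interval the kernel is continuous, so the almost everywhere bound holds everywhere there and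
  passes to the closure; at the endpoint 1 the continuous extension takes the value that bounds the
  whole kernel.\<close>

lemma abs_FW_Kd_le: "\<bar>FW_Kd x\<bar> \<le> FW_Kd_norm"
proof -
  let ?M = "lebesgue_on {0..1::real}" and ?g = "\<lambda>x. ereal \<bar>FW_Kd x\<bar>"
  define s where "s = esssup ?M ?g"
  have m: "?g \<in> borel_measurable ?M"
    by (intro borel_measurable_ereal borel_measurable_abs measurable_restrict_space1 measurable_completion) simp
  have "AE x in ?M. ?g x \<le> s" unfolding s_def by (rule esssup_AE)
  then have "AE x in lebesgue. x \<in> {0..1} \<longrightarrow> ?g x \<le> s"
    by (subst (asm) AE_restrict_space_iff) auto
  then have AE: "AE x \<in> {0<..<1} in lebesgue. x \<in> {x. ereal \<bar>FW_c * sinh (x - 1/2)\<bar> \<le> s}"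
  proof eventually_elim
    case (elim x)
    have "frac x = x" if "x \<in> {0<..<1}" using that by (simp add: frac_eq)
    with elim show ?case by (auto simp: FW_Kd_def simp flip: FW_c_def)
  qed
  have closed: "closed {x. ereal \<bar>FW_c * sinh (x - 1/2)\<bar> \<le> s}"
    by (intro closed_Collect_le continuous_intros)
  have sub: "{0<..<1} \<subseteq> {x. ereal \<bar>FW_c * sinh (x - 1/2)\<bar> \<le> s}"
    using mem_closed_if_AE_lebesgue_open[OF _ closed AE] by auto
  then have "closure {0<..<1::real} \<subseteq> {x. ereal \<bar>FW_c * sinh (x - 1/2)\<bar> \<le> s}"
    using closed by (rule closure_minimal)
  then have "(1::real) \<in> {x. ereal \<bar>FW_c * sinh (x - 1/2)\<bar> \<le> s}"
    by (rule subsetD) (simp add: closure_greaterThanLessThan)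
  then have lower: "ereal (FW_c * sinh (1/2)) \<le> s"
    using FW_c_pos by (simp add: abs_mult)
  have upper: "s \<le> ereal (FW_c * sinh (1/2))"
    unfolding s_def by (rule esssup_I[OF m]) (simp add: abs_FW_Kd_le_sup)
  have "s = ereal (FW_c * sinh (1/2))" using lower upper by (rule antisym[rotated])
  then have "FW_Kd_norm = FW_c * sinh (1/2)"
    by (simp add: FW_Kd_norm_def s_def)
  then show ?thesis using abs_FW_Kd_le_sup by simp
qed

text \<open>K' is the derivative of a continuous periodic function. Splitting at the jump y = frac
  x, the two antiderivatives agree across the jump because cosh is even, and across the period
  because both give cosh (f - 1/2).\<close>

lemma integral_FW_Kd: "(\<integral>y. FW_Kd (x - y) \<partial>iv 1) = 0"
proof -
  interpret finite_measure "iv 1" by simp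
  define f where "f = frac x"
  have f: "0 \<le> f" "f < 1" by (simp_all add: f_def frac_lt_1)
  have x: "x = of_int \<lfloor>x\<rfloor> + f" by (simp add: f_def frac_def)
  have l: "FW_Kd (x - y) = FW_c * sinh (f - y - 1/2)" if "0 \<le> y" "y \<le> f" for y
  proof -
    have "x - y - (f - y) = of_int \<lfloor>x\<rfloor>" using x by simp
    then have "x - y - (f - y) \<in> \<int>" by (metis Ints_of_int)
    then have "frac (x - y) = f - y"
      by (subst frac_unique_iff) (use that f in auto)
    then show ?thesis by (simp add: FW_Kd_def flip: FW_c_def)
  qed
  have r: "FW_Kd (x - y) = FW_c * sinh (f - y + 1/2)" if "f < y" "y < 1" for y
  proof -
    have "x - y - (f - y + 1) = of_int (\<lfloor>x\<rfloor> - 1)" using x by simp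
    then have "x - y - (f - y + 1) \<in> \<int>" by (metis Ints_of_int)
    then have "frac (x - y) = f - y + 1"
      by (subst frac_unique_iff) (use that f in auto)
    then show ?thesis by (simp add: FW_Kd_def flip: FW_c_def)
  qed
  have "((\<lambda>y. FW_c * sinh (f - y - 1/2)) has_integral
      (- FW_c * cosh (f - f - 1/2) - (- FW_c * cosh (f - 0 - 1/2)))) {0..f}"
    by (rule fundamental_theorem_of_calculus)
       (use f in \<open>auto intro!: derivative_eq_intros simp flip: has_real_derivative_iff_has_vector_derivative\<close>)
  then have i1: "((\<lambda>y. FW_Kd (x - y)) has_integral
      (- FW_c * cosh (f - f - 1/2) - (- FW_c * cosh (f - 0 - 1/2)))) {0..f}"
    by (rule has_integral_eq[rotated]) (use l in auto)
  have "((\<lambda>y. FW_c * sinh (f - y + 1/2)) has_integral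
      (- FW_c * cosh (f - 1 + 1/2) - (- FW_c * cosh (f - f + 1/2)))) (cbox f 1)"
    unfolding box_real
    by (rule fundamental_theorem_of_calculus)
       (use f in \<open>auto intro!: derivative_eq_intros simp flip: has_real_derivative_iff_has_vector_derivative\<close>)
  then have i2: "((\<lambda>y. FW_Kd (x - y)) has_integral
      (- FW_c * cosh (f - 1 + 1/2) - (- FW_c * cosh (f - f + 1/2)))) {f..1}"
    unfolding box_real[symmetric]
    by (rule has_integral_spike_interior) (use r in auto)
  have "((\<lambda>y. FW_Kd (x - y)) has_integral 0) {0..1}"
    using has_integral_combine[OF _ _ i1 i2] f by (simp add: cosh_minus)
  then have "integral {0..1} (\<lambda>y. FW_Kd (x - y)) = 0" by (rule integral_unique)
  moreover have m: "(\<lambda>y. FW_Kd (x - y)) \<in> borel_measurable borel" by measurable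
  moreover have "set_integrable lborel {0..1} (\<lambda>y. FW_Kd (x - y))"
    unfolding set_integrable_def
  proof (rule integrableI_bounded_set_indicator[where B = "FW_Kd_norm"])
    show "AE y in lborel. y \<in> {0..1} \<longrightarrow> norm (FW_Kd (x - y)) \<le> FW_Kd_norm"
      by (simp add: abs_FW_Kd_le)
  qed (use m in \<open>auto simp: emeasure_lborel_Icc_eq\<close>)
  ultimately show ?thesis
    by (simp add: integral_iv set_borel_integral_eq_integral(2))
qed

subsection \<open>Borel representatives of entropy solutions\<close>

text \<open>Lebesgue measure is a completion, so a Borel version exists; truncating it turns the
  essential bound into a pointwise one.\<close>

lemma ex_bounded_borel_representative:
  fixes f :: "'a::euclidean_space \<Rightarrow> real"
  assumes "f \<in> borel_measurable lebesgue" "AE x in lebesgue_on S. \<bar>f x\<bar> \<le> M" "S \<in> sets lebesgue"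
  obtains F where "bdd_meas borel F" "AE x in lborel. x \<in> S \<longrightarrow> f x = F x"
proof -
  obtain g where g: "g \<in> borel_measurable lborel" and eq: "AE x in lborel. f x = g x"
    using completion_ex_borel_measurable_real[OF assms(1)] by blast
  have [measurable]: "g \<in> borel_measurable borel" using g by simp
  define F where "F x = max (- \<bar>M\<bar>) (min \<bar>M\<bar> (g x))" for x
  have "F \<in> borel_measurable borel" unfolding F_def by measurable
  then have "bdd_meas borel F"
    by (rule bdd_measI[where B = "\<bar>M\<bar>"]) (auto simp: F_def)
  moreover have "AE x in lebesgue. x \<in> S \<longrightarrow> \<bar>f x\<bar> \<le> M"
    using assms(2,3) by (subst (asm) AE_restrict_space_iff) auto
  then have "AE x in lborel. x \<in> S \<longrightarrow> \<bar>f x\<bar> \<le> M" by (simp add: AE_completion_iff)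
  with eq have "AE x in lborel. x \<in> S \<longrightarrow> f x = F x"
    by eventually_elim (auto simp: F_def)
  ultimately show ?thesis by (rule that)
qed

lemma ex_bounded_borel_representative_T:
  assumes "Linf_T f"
  obtains F where "bdd_meas borel F" "AE x in iv 1. f x = F x"
proof -
  obtain M where M: "AE x in lebesgue_on {0..1}. \<bar>f x\<bar> \<le> M" and f: "f \<in> borel_measurable lebesgue"
    using assms unfolding Linf_T_def by blast
  have "{0..1::real} \<in> sets lebesgue" by simp
  from ex_bounded_borel_representative[OF f M this] that show ?thesis
    unfolding AE_iv_iff by blast
qed

text \<open>Completeness transfers the measurability of g to f on the interval. This covers
  integrands built from the original solution, such as inner integrals as functions of time, whose
  measurability is not given.\<close>

lemma LINT_lebesgue_eq_iv:
  fixes f g :: "real \<Rightarrow> real"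
  assumes g [measurable]: "g \<in> borel_measurable borel" and eq: "AE x in iv T. f x = g x"
  shows "(LINT x:{0..T}|lebesgue. f x) = (\<integral>x. g x \<partial>iv T)"
proof -
  let ?i = "\<lambda>h x. indicator {0..T} x *\<^sub>R h x :: real"
  have gm: "?i g \<in> borel_measurable lborel" by measurable
  have ae: "AE x in lebesgue. ?i g x = ?i f x"
    using eq unfolding AE_iv_iff AE_completion_iff
    by eventually_elim (auto simp: indicator_def)
  have "?i f \<in> borel_measurable lebesgue"
    by (rule borel_measurable_AE[OF measurable_completion[OF gm] ae])
  then have "(LINT x:{0..T}|lebesgue. f x) = (LINT x:{0..T}|lebesgue. g x)"
    unfolding set_lebesgue_integral_def using ae measurable_completion[OF gm]
    by (intro integral_cong_AE) auto
  also have "\<dots> = (LINT x:{0..T}|lborel. g x)"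
    unfolding set_lebesgue_integral_def by (rule integral_completion[OF gm])
  finally show ?thesis by (simp add: integral_iv)
qed

text \<open>The convolution of K' with the time slice of U, without the Kruzkov constant and defined
  on the whole plane.\<close>

definition FW_source :: "(real \<times> real \<Rightarrow> real) \<Rightarrow> real \<times> real \<Rightarrow> real" where
  "FW_source U p = (\<integral>y. FW_Kd (fst p - y) * U (y, snd p) \<partial>iv 1)"

lemma bdd_meas_FW_source:
  assumes "bdd_meas borel U"
  shows "bdd_meas borel (FW_source U)"
proof -
  interpret finite_measure "iv 1" by simp
  have "bdd_meas (borel \<Otimes>\<^sub>M iv 1) (\<lambda>z. FW_Kd (fst (fst z) - snd z) * U (snd z, snd (fst z)))"
    by (intro bdd_meas_mult bdd_meas_comp[OF bdd_meas_FW_Kd] bdd_meas_comp[OF assms])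
       (simp_all flip: borel_prod)
  from bdd_meas_integral[OF this] show ?thesis
    by (simp add: FW_source_def[abs_def])
qed

lemma sgn_times_square_diff: "sgn (a - b) * (a\<^sup>2 - b\<^sup>2) / 2 = flux a b"
  for a b :: real
  by (simp add: flux_def sgn_if abs_if power2_eq_square algebra_simps)

section \<open>Product test functions are admissible\<close>

context
  fixes w w' a a' :: "real \<Rightarrow> real"
  assumes test: "product_test w w' a a'"
begin

lemma product_test_space:
  "0 \<le> w x" "w (x + 1) = w x" "(w has_real_derivative w' x) (at x)" "continuous_on UNIV w'"
  using test by (simp_all add: product_test_def)

lemma product_test_time:
  "0 \<le> a t" "(a has_real_derivative a' t) (at t)" "continuous_on UNIV a'"
  "\<exists>R. \<forall>t. R < \<bar>t\<bar> \<longrightarrow> a t = 0"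
  using test by (simp_all add: product_test_def)

lemma product_test_continuous: "continuous_on UNIV w" "continuous_on UNIV a"
  by (rule has_real_derivative_imp_continuous_on product_test_space product_test_time)+

lemma product_test_bdd_space: "bdd_meas borel w" "bdd_meas borel w'"
proof -
  show "bdd_meas borel w"
    by (rule bdd_meas_periodic) (rule product_test_continuous product_test_space)+
  have "w' (x + 1) = w' x" for x
  proof -
    have "((\<lambda>x. w (x + 1)) has_real_derivative w' (x + 1)) (at x)"
      using DERIV_shift_left[OF product_test_space(3), of "-1" x] by simp
    moreover have "(\<lambda>x. w (x + 1)) = w" by (rule ext) (rule product_test_space)
    ultimately have "(w has_real_derivative w' (x + 1)) (at x)" by simp
    then show ?thesis by (rule DERIV_unique[OF _ product_test_space(3)])
  qed
  with product_test_space(4) show "bdd_meas borel w'" by (rule bdd_meas_periodic)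
qed

lemma product_test_bdd_time: "bdd_meas borel a" "bdd_meas borel a'"
proof -
  obtain R where R: "\<And>t. R < \<bar>t\<bar> \<Longrightarrow> a t = 0" using product_test_time(4) by blast
  show "bdd_meas borel a"
    by (rule bdd_meas_compact_support[OF product_test_continuous(2), where a = "- \<bar>R\<bar>" and b = "\<bar>R\<bar>"])
       (rule R, auto)
  show "bdd_meas borel a'"
  proof (rule bdd_meas_compact_support[OF product_test_time(3), where a = "- \<bar>R\<bar> - 1" and b = "\<bar>R\<bar> + 1"])
    fix x assume "x \<notin> {- \<bar>R\<bar> - 1..\<bar>R\<bar> + 1}"
    then have x: "x \<in> {y. \<bar>R\<bar> < \<bar>y\<bar>}" by auto
    have "open {y::real. \<bar>R\<bar> < \<bar>y\<bar>}" by (intro open_Collect_less continuous_intros)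
    then have "(a has_real_derivative 0) (at x)"
    proof (rule has_field_derivative_transform_within_open[OF DERIV_const[of 0] _ x])
      show "0 = a y" if "y \<in> {y. \<bar>R\<bar> < \<bar>y\<bar>}" for y
        using R[of y] that by simp
    qed
    then show "a' x = 0" by (rule DERIV_unique[OF product_test_time(2)])
  qed
qed

lemma product_test_FW_test: "FW_test (\<lambda>x t. w x * a t) (\<lambda>x t. w' x * a t) (\<lambda>x t. w x * a' t)"
proof -
  have fst: "continuous_on UNIV (\<lambda>p :: real \<times> real. f (fst p))"
    and snd: "continuous_on UNIV (\<lambda>p :: real \<times> real. f (snd p))"
    if "continuous_on UNIV f" for f :: "real \<Rightarrow> real"
    by (rule continuous_on_compose2[OF that], auto intro!: continuous_intros)+
  note c = fst[OF product_test_continuous(1)] snd[OF product_test_continuous(2)]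
    fst[OF product_test_space(4)] snd[OF product_test_time(3)]
  obtain R where R: "\<And>t. R < \<bar>t\<bar> \<Longrightarrow> a t = 0" using product_test_time(4) by blast
  show ?thesis
    unfolding FW_test_def
  proof (intro conjI allI)
    show "((\<lambda>s. w s * a t) has_real_derivative w' x * a t) (at x)" for x t
      by (rule DERIV_cmult_right[OF product_test_space(3)])
    show "((\<lambda>s. w x * a s) has_real_derivative w x * a' t) (at t)" for x t
      by (rule DERIV_cmult[OF product_test_time(2)])
    show "\<exists>R. \<forall>x t. R < \<bar>t\<bar> \<longrightarrow> w x * a t = 0" using R by auto
    show "0 \<le> w x * a t" for x t by (intro mult_nonneg_nonneg product_test_space product_test_time)
    show "w (x + 1) * a t = w x * a t" for x t by (simp add: product_test_space)
  qed (intro continuous_on_mult c)+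
qed

end

text \<open>The slab puts space first, whereas the entropy inequalities integrate over time last;
  the exceptional set is therefore needed slice by slice in time.\<close>

lemma AE_slab_swap:
  assumes "AE p in slab T. P p"
  shows "AE t in iv T. AE x in iv 1. P (x, t)"
proof -
  interpret I: finite_measure "iv 1" by simp
  interpret IT: finite_measure "iv T" by simp
  interpret Q: pair_sigma_finite "iv T" "iv 1" ..
  interpret Q': pair_sigma_finite "iv 1" "iv T" ..
  have "AE z in distr (iv T \<Otimes>\<^sub>M iv 1) (slab T) (\<lambda>(x, y). (y, x)). P z"
    using assms by (subst (asm) Q'.distr_pair_swap)
  then have "AE z in iv T \<Otimes>\<^sub>M iv 1. P (case z of (x, y) \<Rightarrow> (y, x))"
    by (rule AE_distrD[rotated]) measurable
  from Q.AE_pair[OF this] show ?thesis by simp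
qed

lemma FW_entropy_solutionD:
  assumes "FW_entropy_solution T u0 u"
  shows "Linf_T u0"
    and "(\<lambda>p. u (fst p) (snd p)) \<in> borel_measurable lebesgue"
    and "\<exists>M. AE p in lebesgue_on ({0..1} \<times> {0..T}). \<bar>u (fst p) (snd p)\<bar> \<le> M"
    and "\<forall>t\<in>{0..T}. Linf_T (\<lambda>x. u x t)"
    and "\<forall>g. set_integrable lebesgue {0..1} g \<longrightarrow>
        continuous_on {0..T} (\<lambda>t. LINT x:{0..1}|lebesgue. u x t * g x)"
    and "\<forall>lam ph phx pht. FW_test ph phx pht \<longrightarrow>
        0 \<le> (LINT t:{0..T}|lebesgue. LINT x:{0..1}|lebesgue.
                 \<bar>u x t - lam\<bar> * pht x t
               + sgn (u x t - lam) * ((u x t)\<^sup>2 - lam\<^sup>2) / 2 * phx x t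
               - sgn (u x t - lam) * FW_conv FW_Kd (\<lambda>y. u y t - lam) x * ph x t)
           + (LINT x:{0..1}|lebesgue. \<bar>u0 x - lam\<bar> * ph x 0)"
  using assms unfolding FW_entropy_solution_def by - (elim conjE, assumption)+

text \<open>U represents u as a function on space-time, so the slices agree for almost every t only.
  Nothing is claimed at a prescribed time.\<close>

lemma ex_borel_entropy_solution:
  assumes T: "0 < T" and sol: "FW_entropy_solution T u0 u"
  obtains U0 U where "bdd_meas borel U0" "bdd_meas borel U" "AE x in iv 1. u0 x = U0 x"
    "AE t in iv T. AE x in iv 1. u x t = U (x, t)" "entropy_ineq T U0 U (FW_source U)"
proof -
  obtain U0 where U0: "bdd_meas borel U0" "AE x in iv 1. u0 x = U0 x"
    using ex_bounded_borel_representative_T[OF FW_entropy_solutionD(1)[OF sol]] by blast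
  obtain M where M: "AE p in lebesgue_on ({0..1} \<times> {0..T}). \<bar>u (fst p) (snd p)\<bar> \<le> M"
    using FW_entropy_solutionD(3)[OF sol] by blast
  have "({0..1} \<times> {0..T} :: (real \<times> real) set) \<in> sets lebesgue"
    by (intro sets_completionI_sets) (simp add: borel_Times)
  from ex_bounded_borel_representative[OF FW_entropy_solutionD(2)[OF sol] M this]
  obtain U where U: "bdd_meas borel U" "AE p in lborel. p \<in> {0..1} \<times> {0..T} \<longrightarrow> u (fst p) (snd p) = U p"
    by blast
  have ae: "AE t in iv T. AE x in iv 1. u x t = U (x, t)"
    using AE_slab_swap[OF AE_slabI[OF U(2)]] by simp
  have sec: "bdd_meas borel (\<lambda>x. U (x, t))" for t
    by (rule bdd_meas_comp[OF U(1)]) (simp flip: borel_prod)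
  note Sb = bdd_meas_FW_source[OF U(1)]
  interpret I: finite_measure "iv 1" by simp
  have ent: "entropy_ineq T U0 U (FW_source U)"
    unfolding entropy_ineq_def
  proof (intro allI impI)
    fix c w w' a a' assume test: "product_test w w' a a'"
    note bw = product_test_bdd_space[OF test] and ba = product_test_bdd_time[OF test]
    define E where "E p = \<bar>U p - c\<bar> * a' (snd p) * w (fst p) + flux (U p) c * a (snd p) * w' (fst p)
        - sgn (U p - c) * FW_source U p * a (snd p) * w (fst p)" for p
    have snd_l: "bdd_meas (slab T) (\<lambda>p. f (snd p))" "bdd_meas (slab T) (\<lambda>p. f (fst p))" if "bdd_meas borel f" for f
      by (rule bdd_meas_comp[OF that], measurable)+
    have bE: "bdd_meas (slab T) E"
      unfolding E_def
      by (intro bdd_meas_add bdd_meas_diff bdd_meas_mult bdd_meas_abs bdd_meas_sgn bdd_meas_flux bdd_meas_const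
          bdd_meas_slab[OF U(1)] bdd_meas_slab[OF Sb] snd_l[OF ba(1)] snd_l[OF ba(2)] snd_l[OF bw(1)] snd_l[OF bw(2)])
    have bE': "bdd_meas (iv T \<Otimes>\<^sub>M iv 1) (\<lambda>z. E (snd z, fst z))"
      by (rule bdd_meas_comp[OF bE]) measurable
    let ?inner = "\<lambda>t. LINT x:{0..1}|lebesgue.
                 \<bar>u x t - c\<bar> * (w x * a' t)
               + sgn (u x t - c) * ((u x t)\<^sup>2 - c\<^sup>2) / 2 * (w' x * a t)
               - sgn (u x t - c) * FW_conv FW_Kd (\<lambda>y. u y t - c) x * (w x * a t)"
    have inner: "AE t in iv T. ?inner t = (\<integral>x. E (x, t) \<partial>iv 1)"
      using ae
    proof eventually_elim
      case (elim t)
      \<comment> \<open>For a good t this holds at every x, since a null set of y does not affect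
        the convolution; the constant c drops out by \<open>integral_FW_Kd\<close>.\<close>
      have conv: "FW_conv FW_Kd (\<lambda>y. u y t - c) x = FW_source U (x, t)" for x
      proof -
        have b: "bdd_meas borel (\<lambda>y. FW_Kd (x - y))" by (rule bdd_meas_comp[OF bdd_meas_FW_Kd]) measurable
        have "FW_conv FW_Kd (\<lambda>y. u y t - c) x = (\<integral>y. FW_Kd (x - y) * (U (y, t) - c) \<partial>iv 1)"
          unfolding FW_conv_def
        proof (rule LINT_lebesgue_eq_iv)
          show "(\<lambda>y. FW_Kd (x - y) * (U (y, t) - c)) \<in> borel_measurable borel"
            by (rule bdd_measD) (intro bdd_meas_mult bdd_meas_diff bdd_meas_const b sec)
          show "AE y in iv 1. FW_Kd (x - y) * (u y t - c) = FW_Kd (x - y) * (U (y, t) - c)"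
            using elim by eventually_elim simp
        qed
        also have "\<dots> = (\<integral>y. FW_Kd (x - y) * U (y, t) - FW_Kd (x - y) * c \<partial>iv 1)"
          by (simp add: algebra_simps)
        also have "\<dots> = (\<integral>y. FW_Kd (x - y) * U (y, t) \<partial>iv 1) - (\<integral>y. FW_Kd (x - y) * c \<partial>iv 1)"
          by (rule Bochner_Integration.integral_diff; intro I.bdd_meas_integrable bdd_meas_iv bdd_meas_mult bdd_meas_const b sec)
        finally show ?thesis by (simp add: FW_source_def integral_FW_Kd)
      qed
      show ?case
        unfolding conv
      proof (rule LINT_lebesgue_eq_iv)
        show "(\<lambda>x. E (x, t)) \<in> borel_measurable borel"
          using bdd_measD[OF bdd_meas_section[OF bE', of t]] by simp
        show "AE x in iv 1. \<bar>u x t - c\<bar> * (w x * a' t)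
               + sgn (u x t - c) * ((u x t)\<^sup>2 - c\<^sup>2) / 2 * (w' x * a t)
               - sgn (u x t - c) * FW_source U (x, t) * (w x * a t) = E (x, t)"
          using elim
        proof eventually_elim
          case (elim x)
          show ?case unfolding elim sgn_times_square_diff E_def by (simp add: mult_ac)
        qed
      qed
    qed
    have "0 \<le> (LINT t:{0..T}|lebesgue. ?inner t) + (LINT x:{0..1}|lebesgue. \<bar>u0 x - c\<bar> * (w x * a 0))"
      using FW_entropy_solutionD(6)[OF sol, rule_format, OF product_test_FW_test[OF test], of c] .
    also have "(LINT t:{0..T}|lebesgue. ?inner t) = (\<integral>t. \<integral>x. E (x, t) \<partial>iv 1 \<partial>iv T)"
      using bdd_measD[OF I.bdd_meas_integral[OF bE']] by (intro LINT_lebesgue_eq_iv inner) simp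
    also have "\<dots> = (\<integral>p. E p \<partial>slab T)"
      by (rule integral_pair_snd[OF finite_measure_iv finite_measure_iv bE])
    also have "(LINT x:{0..1}|lebesgue. \<bar>u0 x - c\<bar> * (w x * a 0)) = (\<integral>x. a 0 * (\<bar>U0 x - c\<bar> * w x) \<partial>iv 1)"
    proof (rule LINT_lebesgue_eq_iv)
      show "(\<lambda>x. a 0 * (\<bar>U0 x - c\<bar> * w x)) \<in> borel_measurable borel"
        by (rule bdd_measD) (intro bdd_meas_mult bdd_meas_abs bdd_meas_diff bdd_meas_const U0 bw)
      show "AE x in iv 1. \<bar>u0 x - c\<bar> * (w x * a 0) = a 0 * (\<bar>U0 x - c\<bar> * w x)"
        using U0(2) by eventually_elim simp
    qed
    finally show "0 \<le> (\<integral>p. \<bar>U p - c\<bar> * a' (snd p) * w (fst p) + flux (U p) c * a (snd p) * w' (fst p)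
              - sgn (U p - c) * FW_source U p * a (snd p) * w (fst p) \<partial>slab T)
        + a 0 * (\<integral>x. \<bar>U0 x - c\<bar> * w x \<partial>iv 1)"
      by (simp add: E_def)
  qed
  show ?thesis by (rule that[OF U0(1) U(1) U0(2) ae ent])
qed

subsection \<open>Gronwall argument and conclusion\<close>

lemma bdd_meas_slice:
  fixes W :: "real \<times> real \<Rightarrow> real"
  shows "bdd_meas borel W \<Longrightarrow> bdd_meas borel (\<lambda>x. W (x, t))"
  by (erule bdd_meas_comp) (simp flip: borel_prod)

text \<open>The bound does not depend on the space variable, so a further integration over the unit
  interval keeps the constant.\<close>

lemma FW_source_diff_le:
  assumes "bdd_meas borel U" "bdd_meas borel V"
  shows "\<bar>FW_source U p - FW_source V p\<bar> \<le> FW_Kd_norm * (\<integral>y. \<bar>U (y, snd p) - V (y, snd p)\<bar> \<partial>iv 1)"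
proof -
  interpret finite_measure "iv 1" by simp
  have b: "bdd_meas (iv 1) (\<lambda>y. FW_Kd (fst p - y))"
    by (rule bdd_meas_comp[OF bdd_meas_FW_Kd]) measurable
  have sec: "bdd_meas (iv 1) (\<lambda>y. W (y, snd p))" if "bdd_meas borel W" for W :: "real \<times> real \<Rightarrow> real"
    by (rule bdd_meas_iv[OF bdd_meas_slice[OF that]])
  note int = bdd_meas_integrable bdd_meas_mult bdd_meas_diff bdd_meas_abs bdd_meas_const b
    sec[OF assms(1)] sec[OF assms(2)]
  have eq: "FW_source U p - FW_source V p
      = (\<integral>y. FW_Kd (fst p - y) * U (y, snd p) - FW_Kd (fst p - y) * V (y, snd p) \<partial>iv 1)"
    unfolding FW_source_def by (rule Bochner_Integration.integral_diff[symmetric]; intro int)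
  have "\<bar>FW_source U p - FW_source V p\<bar>
      \<le> (\<integral>y. \<bar>FW_Kd (fst p - y) * U (y, snd p) - FW_Kd (fst p - y) * V (y, snd p)\<bar> \<partial>iv 1)"
    unfolding eq by (rule integral_abs_bound)
  also have "\<dots> \<le> (\<integral>y. FW_Kd_norm * \<bar>U (y, snd p) - V (y, snd p)\<bar> \<partial>iv 1)"
  proof (rule integral_mono)
    show "\<bar>FW_Kd (fst p - y) * U (y, snd p) - FW_Kd (fst p - y) * V (y, snd p)\<bar>
        \<le> FW_Kd_norm * \<bar>U (y, snd p) - V (y, snd p)\<bar>" for y
      unfolding right_diff_distrib[symmetric] abs_mult by (intro mult_right_mono abs_FW_Kd_le) simp
  qed (intro int)+
  finally show ?thesis by simp
qed

text \<open>With exp (- L t) as integrating factor, \<eta>' + L \<eta> equals - exp (- L t) \<theta>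
  (t - a) for nonnegative t. The growth term is absorbed exactly, and only a weighted average of the
  distance over times between a and a + e remains.\<close>

lemma weighted_L1_comparison:
  fixes a e :: real
  assumes T: "0 < T"
    and bdd: "bdd_meas borel U0" "bdd_meas borel V0" "bdd_meas borel U" "bdd_meas borel V"
    and ent: "entropy_ineq T U0 U (FW_source U)" "entropy_ineq T V0 V (FW_source V)"
    and tk: "time_kernel e X \<theta> \<theta>'" and ae: "0 \<le> a" "0 < e" "a + e < T"
  shows "(\<integral>t. (\<integral>x. \<bar>U (x, t) - V (x, t)\<bar> \<partial>iv 1) * exp (- FW_Kd_norm * t) * \<theta> (t - a) \<partial>iv T)
      \<le> (\<integral>x. \<bar>U0 x - V0 x\<bar> \<partial>iv 1)"
proof -
  let ?L = FW_Kd_norm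
  interpret I: finite_measure "iv 1" by simp
  interpret IT: finite_measure "iv T" by simp
  interpret S: finite_measure "slab T" by simp
  obtain P P' where P: "\<And>t. 0 \<le> P t" "\<And>t. (P has_real_derivative P' t) (at t)" "continuous_on UNIV P'"
    "\<And>t. t \<notin> {-1..a + e} \<Longrightarrow> P t = 0" "\<And>t. t \<notin> {-1..a + e} \<Longrightarrow> P' t = 0"
    "\<And>t. 0 \<le> t \<Longrightarrow> P t = X (t - a)" "\<And>t. 0 \<le> t \<Longrightarrow> P' t = - \<theta> (t - a)"
    by (rule ex_cutoff[OF tk ae(2,1)]) blast
  define \<eta> \<eta>' where "\<eta> t = exp (- ?L * t) * P t" and "\<eta>' t = exp (- ?L * t) * (P' t - ?L * P t)" for t
  have P_cont: "continuous_on UNIV P" by (rule has_real_derivative_imp_continuous_on[OF P(2)])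
  have \<eta>_deriv: "(\<eta> has_real_derivative \<eta>' t) (at t)" for t
  proof -
    have "((\<lambda>t. exp (- ?L * t)) has_real_derivative exp (- ?L * t) * (- ?L)) (at t)"
      by (auto intro!: derivative_eq_intros)
    from DERIV_mult[OF this P(2)[of t]] show ?thesis
      unfolding \<eta>_def \<eta>'_def by (simp add: algebra_simps)
  qed
  have \<eta>'_cont: "continuous_on UNIV \<eta>'"
    unfolding \<eta>'_def by (intro continuous_intros P_cont P(3))
  have b\<eta>: "bdd_meas borel \<eta>"
    by (rule bdd_meas_compact_support[OF has_real_derivative_imp_continuous_on[OF \<eta>_deriv],
        where a = "-1" and b = "a + e"])
       (simp add: \<eta>_def P(4))
  have b\<eta>': "bdd_meas borel \<eta>'"
    by (rule bdd_meas_compact_support[OF \<eta>'_cont, where a = "-1" and b = "a + e"])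
       (simp add: \<eta>'_def P(4,5))
  define D where "D t = (\<integral>x. \<bar>U (x, t) - V (x, t)\<bar> \<partial>iv 1)" for t
  have bD: "bdd_meas borel D"
  proof -
    have "bdd_meas (borel \<Otimes>\<^sub>M iv 1) (\<lambda>z. \<bar>U (snd z, fst z) - V (snd z, fst z)\<bar>)"
      by (intro bdd_meas_abs bdd_meas_diff bdd_meas_comp[OF bdd(3)] bdd_meas_comp[OF bdd(4)])
         (simp_all flip: borel_prod)
    from I.bdd_meas_integral[OF this] show ?thesis by (simp add: D_def[abs_def])
  qed
  have lift: "bdd_meas (slab T) (\<lambda>p. f (snd p))" if "bdd_meas borel f" for f
    by (rule bdd_meas_comp[OF that]) measurable
  have slab_D: "(\<integral>p. \<bar>U p - V p\<bar> * f (snd p) \<partial>slab T) = (\<integral>t. D t * f t \<partial>iv T)" if "bdd_meas borel f" for f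
  proof -
    have "bdd_meas (slab T) (\<lambda>p. \<bar>U p - V p\<bar> * f (snd p))"
      by (intro bdd_meas_mult bdd_meas_abs bdd_meas_diff bdd_meas_slab bdd lift that)
    from integral_pair_snd[OF finite_measure_iv finite_measure_iv this]
    show ?thesis by (simp add: D_def)
  qed
  have source: "(\<integral>p. \<bar>FW_source U p - FW_source V p\<bar> * \<eta> (snd p) \<partial>slab T) \<le> (\<integral>t. ?L * (D t * \<eta> t) \<partial>iv T)"
  proof -
    have "(\<integral>p. \<bar>FW_source U p - FW_source V p\<bar> * \<eta> (snd p) \<partial>slab T) \<le> (\<integral>p. 1 * (?L * D (snd p) * \<eta> (snd p)) \<partial>slab T)"
    proof (rule integral_mono)
      show "\<bar>FW_source U p - FW_source V p\<bar> * \<eta> (snd p) \<le> 1 * (?L * D (snd p) * \<eta> (snd p))" for p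
        using mult_right_mono[OF FW_source_diff_le[OF bdd(3,4), of p], of "\<eta> (snd p)"] P(1)
        by (simp add: D_def \<eta>_def)
    qed (intro S.bdd_meas_integrable bdd_meas_mult bdd_meas_abs bdd_meas_diff bdd_meas_const
        bdd_meas_slab bdd_meas_FW_source bdd lift bD b\<eta>)+
    also have "\<dots> = (\<integral>t. ?L * D t * \<eta> t \<partial>iv T)"
      using slab_integral_product[of "\<lambda>_. 1" "\<lambda>t. ?L * D t * \<eta> t" T]
        bdd_meas_mult[OF bdd_meas_mult[OF bdd_meas_const bD] b\<eta>] measure_iv[of 1]
      by (simp add: bdd_meas_const)
    finally show ?thesis by (simp add: mult.assoc)
  qed
  have "0 \<le> (\<integral>p. \<bar>U p - V p\<bar> * \<eta>' (snd p) \<partial>slab T) + (\<integral>p. \<bar>FW_source U p - FW_source V p\<bar> * \<eta> (snd p) \<partial>slab T)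
      + \<eta> 0 * (\<integral>x. \<bar>U0 x - V0 x\<bar> \<partial>iv 1)"
  proof (rule kruzkov_comparison[OF T bdd bdd_meas_FW_source[OF bdd(3)] bdd_meas_FW_source[OF bdd(4)] b\<eta> b\<eta>' ent _ \<eta>_deriv \<eta>'_cont ae(3)])
    show "0 \<le> \<eta> t" for t using P(1) by (simp add: \<eta>_def)
    show "\<eta>' t = 0" if "a + e \<le> t" for t
      using that ae P(6,7)[of t] tk by (simp add: \<eta>'_def time_kernel_def)
  qed
  also have "\<dots> \<le> (\<integral>t. D t * \<eta>' t \<partial>iv T) + (\<integral>t. ?L * (D t * \<eta> t) \<partial>iv T) + (\<integral>x. \<bar>U0 x - V0 x\<bar> \<partial>iv 1)"
  proof -
    have "\<eta> 0 = 1" using P(6)[of 0] ae tk by (simp add: \<eta>_def time_kernel_def)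
    then show ?thesis using source slab_D[OF b\<eta>'] by simp
  qed
  also have "(\<integral>t. D t * \<eta>' t \<partial>iv T) + (\<integral>t. ?L * (D t * \<eta> t) \<partial>iv T) = (\<integral>t. D t * \<eta>' t + ?L * (D t * \<eta> t) \<partial>iv T)"
    by (rule Bochner_Integration.integral_add[symmetric];
        intro IT.bdd_meas_integrable bdd_meas_mult bdd_meas_const bdd_meas_iv bD b\<eta> b\<eta>')
  also have "\<dots> = (\<integral>t. - (D t * exp (- ?L * t) * \<theta> (t - a)) \<partial>iv T)"
  proof (rule integral_cong_AE)
    have [measurable]: "D \<in> borel_measurable borel" "\<eta> \<in> borel_measurable borel" "\<eta>' \<in> borel_measurable borel"
      "\<theta> \<in> borel_measurable borel"
      using bD b\<eta> b\<eta>' time_kernel_bdd(1)[OF tk] by auto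
    show "(\<lambda>t. D t * \<eta>' t + ?L * (D t * \<eta> t)) \<in> borel_measurable (iv T)" by measurable
    show "(\<lambda>t. - (D t * exp (- ?L * t) * \<theta> (t - a))) \<in> borel_measurable (iv T)" by measurable
    show "AE t in iv T. D t * \<eta>' t + ?L * (D t * \<eta> t) = - (D t * exp (- ?L * t) * \<theta> (t - a))"
      using AE_iv
    proof eventually_elim
      case (elim t)
      then have "P' t = - \<theta> (t - a)" using P(7) by simp
      then show ?case by (simp add: \<eta>_def \<eta>'_def algebra_simps)
    qed
  qed
  finally show ?thesis by (simp add: D_def)
qed

theorem theorem1:
  fixes T :: real and u0 v0 :: "real \<Rightarrow> real" and u v :: "real \<Rightarrow> real \<Rightarrow> real"
  assumes "0 < T"
    and "FW_entropy_solution T u0 u"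
    and "FW_entropy_solution T v0 v"
  shows "\<forall>t\<in>{0..T}.
           (LINT x:{0..1}|lebesgue. \<bar>u x t - v x t\<bar>)
             \<le> exp (t * FW_Kd_norm) * (LINT x:{0..1}|lebesgue. \<bar>u0 x - v0 x\<bar>)"
proof
  fix \<tau> assume \<tau>: "\<tau> \<in> {0..T}"
  let ?L = FW_Kd_norm
  interpret I: finite_measure "iv 1" by simp
  interpret IT: finite_measure "iv T" by simp
  obtain U0 U where U: "bdd_meas borel U0" "bdd_meas borel U" "AE x in iv 1. u0 x = U0 x"
    "AE t in iv T. AE x in iv 1. u x t = U (x, t)" "entropy_ineq T U0 U (FW_source U)"
    by (rule ex_borel_entropy_solution[OF assms(1,2)])
  obtain V0 V where V: "bdd_meas borel V0" "bdd_meas borel V" "AE x in iv 1. v0 x = V0 x"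
    "AE t in iv T. AE x in iv 1. v x t = V (x, t)" "entropy_ineq T V0 V (FW_source V)"
    by (rule ex_borel_entropy_solution[OF assms(1,3)])
  define D where "D t = (\<integral>x. \<bar>U (x, t) - V (x, t)\<bar> \<partial>iv 1)" for t
  define D0 where "D0 = (\<integral>x. \<bar>U0 x - V0 x\<bar> \<partial>iv 1)"
  have D0: "(LINT x:{0..1}|lebesgue. \<bar>u0 x - v0 x\<bar>) = D0"
    unfolding D0_def
  proof (rule LINT_lebesgue_eq_iv)
    show "(\<lambda>x. \<bar>U0 x - V0 x\<bar>) \<in> borel_measurable borel"
      by (rule bdd_measD) (intro bdd_meas_abs bdd_meas_diff U V)
    show "AE x in iv 1. \<bar>u0 x - v0 x\<bar> = \<bar>U0 x - V0 x\<bar>"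
      using U(3) V(3) by eventually_elim simp
  qed
  have Linf: "Linf_T (\<lambda>x. u x \<tau>)" "Linf_T (\<lambda>x. v x \<tau>)"
    by (rule FW_entropy_solutionD(4)[OF assms(2), rule_format, OF \<tau>] FW_entropy_solutionD(4)[OF assms(3), rule_format, OF \<tau>])+
  \<comment> \<open>The single time \<tau> may be exceptional for U and V, so the slices of u and v
    there get representatives of their own.\<close>
  obtain Fu where Fu: "bdd_meas borel Fu" "AE x in iv 1. u x \<tau> = Fu x"
    by (rule ex_bounded_borel_representative_T[OF Linf(1)])
  obtain Fv where Fv: "bdd_meas borel Fv" "AE x in iv 1. v x \<tau> = Fv x"
    by (rule ex_bounded_borel_representative_T[OF Linf(2)])
  \<comment> \<open>Tested against \<^term>\<open>g\<close>, the difference of the solutions is weak-* continuous in time, equals the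
    \<open>L\<^sup>1\<close> distance at \<^term>\<open>\<tau>\<close>, and is bounded by the \<open>L\<^sup>1\<close> distance at almost every other time.\<close>
  define g where "g x = sgn (Fu x - Fv x)" for x
  have bg: "bdd_meas borel g"
    unfolding g_def by (intro bdd_meas_sgn bdd_meas_diff Fu Fv)
  have g_set: "set_integrable lebesgue {0..1} g"
    unfolding set_integrable_def
  proof (rule integrableI_bounded_set_indicator[where B = 1])
    show "g \<in> borel_measurable lebesgue" using bdd_measD[OF bg] by (simp add: measurable_completion)
    show "AE x in lebesgue. x \<in> {0..1} \<longrightarrow> norm (g x) \<le> 1" by (simp add: g_def sgn_if)
  qed (simp_all add: emeasure_lborel_Icc_eq)
  define G where "G t = (LINT x:{0..1}|lebesgue. u x t * g x) - (LINT x:{0..1}|lebesgue. v x t * g x)" for t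
  have "continuous_on {0..T} (\<lambda>t. LINT x:{0..1}|lebesgue. u x t * g x)"
    "continuous_on {0..T} (\<lambda>t. LINT x:{0..1}|lebesgue. v x t * g x)"
    by (rule FW_entropy_solutionD(5)[OF assms(2), rule_format, OF g_set]
        FW_entropy_solutionD(5)[OF assms(3), rule_format, OF g_set])+
  then have G_cont: "continuous_on {0..T} G"
    unfolding G_def by (intro continuous_intros)
  have G_eq: "G t = (\<integral>x. (F x - H x) * g x \<partial>iv 1)"
    if "AE x in iv 1. u x t = F x" "AE x in iv 1. v x t = H x" "bdd_meas borel F" "bdd_meas borel H" for t F H
  proof -
    have "(LINT x:{0..1}|lebesgue. u x t * g x) = (\<integral>x. F x * g x \<partial>iv 1)"
      by (rule LINT_lebesgue_eq_iv[OF bdd_measD[OF bdd_meas_mult[OF that(3) bg]]])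
         (use that(1) in eventually_elim, simp)
    moreover have "(LINT x:{0..1}|lebesgue. v x t * g x) = (\<integral>x. H x * g x \<partial>iv 1)"
      by (rule LINT_lebesgue_eq_iv[OF bdd_measD[OF bdd_meas_mult[OF that(4) bg]]])
         (use that(2) in eventually_elim, simp)
    moreover have "(\<integral>x. F x * g x - H x * g x \<partial>iv 1) = (\<integral>x. F x * g x \<partial>iv 1) - (\<integral>x. H x * g x \<partial>iv 1)"
      by (rule Bochner_Integration.integral_diff; intro I.bdd_meas_integrable bdd_meas_mult bdd_meas_iv that bg)
    ultimately show ?thesis by (simp add: G_def left_diff_distrib)
  qed
  have G\<tau>: "(LINT x:{0..1}|lebesgue. \<bar>u x \<tau> - v x \<tau>\<bar>) = G \<tau>"
  proof -
    have "(LINT x:{0..1}|lebesgue. \<bar>u x \<tau> - v x \<tau>\<bar>) = (\<integral>x. \<bar>Fu x - Fv x\<bar> \<partial>iv 1)"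
      by (rule LINT_lebesgue_eq_iv[OF bdd_measD[OF bdd_meas_abs[OF bdd_meas_diff[OF Fu(1) Fv(1)]]]])
         (use Fu(2) Fv(2) in eventually_elim, simp)
    also have "\<dots> = (\<integral>x. (Fu x - Fv x) * g x \<partial>iv 1)"
      by (simp add: g_def abs_sgn)
    finally show ?thesis using G_eq[OF Fu(2) Fv(2) Fu(1) Fv(1)] by simp
  qed
  have G_le_D: "AE t in iv T. G t \<le> D t"
    using U(4) V(4)
  proof eventually_elim
    case (elim t)
    have "G t = (\<integral>x. (U (x, t) - V (x, t)) * g x \<partial>iv 1)"
      by (rule G_eq[OF elim bdd_meas_slice[OF U(2)] bdd_meas_slice[OF V(2)]])
    also have "\<dots> \<le> D t"
      unfolding D_def
    proof (rule integral_mono)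
      show "(U (x, t) - V (x, t)) * g x \<le> \<bar>U (x, t) - V (x, t)\<bar>" for x
        by (auto simp: g_def sgn_if)
    qed (intro I.bdd_meas_integrable bdd_meas_mult bdd_meas_diff bdd_meas_abs bdd_meas_iv
        bdd_meas_slice[OF U(2)] bdd_meas_slice[OF V(2)] bg)+
    finally show ?case .
  qed
  \<comment> \<open>If this failed, continuity would keep the weighted G above some c > D0 on a time
    window near \<tau>. Since G is at most D almost everywhere, the average of the weighted distance
    over that window would exceed D0 as well.\<close>
  have "exp (- ?L * \<tau>) * G \<tau> \<le> D0"
  proof (rule ccontr)
    assume "\<not> ?thesis"
    then obtain c where c: "D0 < c" "c < exp (- ?L * \<tau>) * G \<tau>"
      using dense not_le by blast
    have "continuous_on {0..T} (\<lambda>t. exp (- ?L * t) * G t)"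
      by (intro continuous_intros G_cont)
    then have "\<exists>r>0. \<forall>t\<in>{0..T}. dist t \<tau> < r \<longrightarrow>
        dist (exp (- ?L * t) * G t) (exp (- ?L * \<tau>) * G \<tau>) < exp (- ?L * \<tau>) * G \<tau> - c"
      using \<tau> c(2) unfolding continuous_on_iff by (auto simp only: diff_gt_0_iff_gt)
    then obtain r where r: "0 < r" "\<And>t. t \<in> {0..T} \<Longrightarrow> dist t \<tau> < r \<Longrightarrow>
        dist (exp (- ?L * t) * G t) (exp (- ?L * \<tau>) * G \<tau>) < exp (- ?L * \<tau>) * G \<tau> - c"
      by blast
    define e where "e = min r T / 4"
    \<comment> \<open>The window from a to a + e lies after \<tau> in the first half of the time
      interval and before it otherwise. Thus it stays between 0 and T, strictly before T, even when
      \<tau> is 0 or T, and within \<open>2 * e\<close> < r of \<tau>.\<close>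
    define a where "a = (if \<tau> < T / 2 then \<tau> + e else \<tau> - 2 * e)"
    have e: "0 < e" "4 * e \<le> r" "4 * e \<le> T" using r(1) assms(1) by (auto simp: e_def)
    have a: "0 \<le> a" "a + e < T" "\<bar>a - \<tau>\<bar> \<le> 2 * e" "\<bar>a + e - \<tau>\<bar> \<le> 2 * e"
      using e \<tau> by (auto simp: a_def)
    have large: "c < exp (- ?L * t) * G t" if "a \<le> t" "t \<le> a + e" for t
    proof -
      have "dist t \<tau> < r" using that a e by (simp add: dist_real_def abs_le_iff abs_less_iff)
      moreover have "t \<in> {0..T}" using that a by simp
      ultimately show ?thesis using r(2)[of t] by (simp add: dist_real_def abs_less_iff)
    qed
    obtain X \<theta> \<theta>' where tk: "time_kernel e X \<theta> \<theta>'" using ex_time_kernel[OF e(1)] by blast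
    have b\<theta>: "bdd_meas borel (\<lambda>t. \<theta> (t - a))"
      by (rule bdd_meas_comp[OF time_kernel_bdd(1)[OF tk]]) measurable
    have bD: "bdd_meas (iv T) D"
    proof -
      have "bdd_meas (iv T \<Otimes>\<^sub>M iv 1) (\<lambda>z. \<bar>U (snd z, fst z) - V (snd z, fst z)\<bar>)"
        by (intro bdd_meas_abs bdd_meas_diff bdd_meas_comp[OF U(2)] bdd_meas_comp[OF V(2)])
           (simp_all flip: borel_prod)
      from I.bdd_meas_integral[OF this] show ?thesis by (simp add: D_def[abs_def])
    qed
    \<comment> \<open>The kernel has mass 1 on the time interval because the whole window lies
      inside it.\<close>
    have "c = c * (\<integral>t. \<theta> (t - a) \<partial>iv T)"
      using integral_time_kernel_fst[OF tk, of T a] assms(1) a tk by (simp add: time_kernel_def)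
    also have "\<dots> = (\<integral>t. c * \<theta> (t - a) \<partial>iv T)" by simp
    also have "\<dots> \<le> (\<integral>t. D t * exp (- ?L * t) * \<theta> (t - a) \<partial>iv T)"
    proof (rule integral_mono_AE)
      show "integrable (iv T) (\<lambda>t. c * \<theta> (t - a))"
        by (intro IT.bdd_meas_integrable bdd_meas_mult bdd_meas_const bdd_meas_iv b\<theta>)
      have b: "bdd_meas borel (\<lambda>t. exp (- ?L * t) * \<theta> (t - a))"
      proof (rule bdd_meas_compact_support[where a = a and b = "a + e"])
        show "continuous_on UNIV (\<lambda>t. exp (- ?L * t) * \<theta> (t - a))"
          by (intro continuous_intros
              has_real_derivative_imp_continuous_on[OF DERIV_shift_left[OF time_kernel_DERIV(2)[OF tk]]])
        show "exp (- ?L * t) * \<theta> (t - a) = 0" if "t \<notin> {a..a + e}" for t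
          using time_kernel_support[OF tk, of "t - a"] that by force
      qed
      have "integrable (iv T) (\<lambda>t. D t * (exp (- ?L * t) * \<theta> (t - a)))"
        by (rule IT.bdd_meas_integrable) (rule bdd_meas_mult[OF bD bdd_meas_iv[OF b]])
      then show "integrable (iv T) (\<lambda>t. D t * exp (- ?L * t) * \<theta> (t - a))"
        by (simp add: mult.assoc)
      show "AE t in iv T. c * \<theta> (t - a) \<le> D t * exp (- ?L * t) * \<theta> (t - a)"
        using G_le_D
      proof eventually_elim
        case (elim t)
        show ?case
        proof (cases "\<theta> (t - a) = 0")
          case False
          then have "a \<le> t" "t \<le> a + e" using time_kernel_support[OF tk, of "t - a"] by auto
          then have "c \<le> G t * exp (- ?L * t)" using large[of t] by (simp add: mult.commute)
          also have "\<dots> \<le> D t * exp (- ?L * t)" using elim by (rule mult_right_mono) simp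
          finally show ?thesis by (rule mult_right_mono) (rule time_kernel_pos[OF tk])
        qed simp
      qed
    qed
    also have "\<dots> \<le> D0"
      unfolding D_def D0_def
      by (rule weighted_L1_comparison[OF assms(1) U(1) V(1) U(2) V(2) U(5) V(5) tk a(1) e(1) a(2)])
    finally show False using c(1) by simp
  qed
  then have "exp (\<tau> * ?L) * (exp (- ?L * \<tau>) * G \<tau>) \<le> exp (\<tau> * ?L) * D0"
    by (rule mult_left_mono) simp
  moreover have "exp (\<tau> * ?L) * exp (- ?L * \<tau>) = 1"
    by (simp add: mult.commute flip: exp_add)
  ultimately show "(LINT x:{0..1}|lebesgue. \<bar>u x \<tau> - v x \<tau>\<bar>) \<le> exp (\<tau> * ?L) * (LINT x:{0..1}|lebesgue. \<bar>u0 x - v0 x\<bar>)"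
    unfolding G\<tau> D0 by (simp only: mult.assoc[symmetric] mult_1_left)
qed

end
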